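(* Assume that $f_i$ is convex and $L$-smooth for all $i=1,\dots,n$, $f$ is $\mu$-quasi strongly convex, $\mu\ge0$, and the expected smoothness condition of the context holds with constant $\mathcal L$. Consider DIANAsr-DQ with $$0<\gamma\le\frac1{4(1+\omega_2)\left(\mathcal L\left(2+\frac{15\omega_1}n\right)+\frac{16L\omega_1}n\right)},\qquad0<\alpha\le\frac1{\omega_1+1}.$$ Then DIANAsr-DQ satisfies the parametric assumption of the context with $A'=\mathcal L(1+\omega_2)\left(2+\frac{3\omega_1}n\right)$, $B_1'=\frac{3\omega_1(1+\omega_2)}n$, $D_1'=\frac{(2+3\omega_1)(1+\omega_2)}{n^2}\sum_{i=1}^n\mathbf E_{\mathcal D_i}\|\nabla f_{\xi_i}(x^* )-\nabla f_i(x^* )\|^2$, $\sigma_{1,k}^2=\sigma_k^2=\frac1n\sum_{i=1}^n\|h_i^k-\nabla f_i(x^* )\|^2$, $B_2'=0$, $\sigma_{2,k}^2\equiv0$, $\rho_1=\alpha$, $\rho_2=1$, $C_1=\alpha(3\mathcal L+4L)$, $C_2=0$, $D_2=\frac{3\alpha}n\sum_{i=1}^n\mathbf E_{\mathcal D_i}\|\nabla f_{\xi_i}(x^* )-\nabla f_i(x^* )\|^2$, $G=0$, $F_1=F_2=0$, $D_3=0$. Moreover, with $M_1=\frac{4\omega_1(1+\omega_2)}{n\alpha}$, $M_2=0$ and $T^0=\|x^0-x^*\|^2+M_1\gamma^2\sigma_{1,0}^2$, for all $K\ge0$ $$\mathbf E[f(\bar x^K)-f(x^* )]\le\left(1-\min\left\{\frac{\gamma\mu}2,\frac\alpha4\right\}\right)^K\frac{4T^0}\gamma+4\gamma(D_1'+M_1D_2)$$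 when $\mu>0$, and $$\mathbf E[f(\bar x^K)-f(x^* )]\le\frac{4T^0}{\gamma K}+4\gamma(D_1'+M_1D_2)$$ when $\mu=0$ (right-hand side read as $+\infty$ for $K=0$).
   Context: $f(x)=\frac1n\sum_{i=1}^nf_i(x)$, $f_i(x)=\frac1m\sum_{j=1}^mf_{ij}(x)$ on $\mathbb R^d$, $f_{ij}$ differentiable. A function is $L$-smooth if it is differentiable with $L$-Lipschitz gradient. $f$ is $\mu$-quasi strongly convex if it has a unique minimizer $x^*$ and $f(x^* )\ge f(x)+\langle\nabla f(x),x^*-x\rangle+\frac\mu2\|x-x^*\|^2$ for all $x$. Stochastic reformulation: $\xi_i=(\xi_{i1},\dots,\xi_{im})$ is a random vector with distribution $\mathcal D_i$, $\mathbf E_{\mathcal D_i}[\xi_{ij}]=1$ for all $i,j$, and $f_{\xi_i}(x)=\frac1m\sum_{j=1}^m\xi_{ij}f_{ij}(x)$. Expected smoothness: for all $i$ and $x$, $\mathbf E_{\mathcal D_i}\|\nabla f_{\xi_i}(x)-\nabla f_{\xi_i}(x^* )\|^2\le2\mathcal LD_{f_i}(x,x^* )$, where $D_h(x,y)=h(x)-h(y)-\langle\nabla h(y),x-y\rangle$. Quantizations: $Q_1,Q_2$ are randomized operators with $\mathbf E[Q_s(x)]=x$, $\mathbf E\|Q_s(x)-x\|^2\le\omega_s\|x\|^2$ for all $x$, $\omega_s>0$, $s=1,2$; every application uses fresh independent randomness. DIANAsr-DQ: given deterministic $x^0,h_1^0,\dots,h_n^0\in\mathbb R^d$; at iteration $k\ge0$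 each worker $i$ samples $\xi_i^k\sim\mathcal D_i$ (independently over $i$ and $k$), computes $\Delta_i^k=Q_1(\nabla f_{\xi_i^k}(x^k)-h_i^k)$ and $h_i^{k+1}=h_i^k+\alpha\Delta_i^k$. The master forms $g^{k,2}=\frac1n\sum_{i=1}^n(h_i^k+\Delta_i^k)$, samples $g^k=Q_2(g^{k,2})$ and broadcasts it; then $x^{k+1}=x^k-\gamma g^k$. Parametric assumption (here the error-feedback vectors are $e^k\equiv0$): with $\mathbf E_k$ the conditional expectation given all randomness generated before iteration $k$, for all $k,K\ge0$: $\mathbf E_k[g^k]=\nabla f(x^k)$; $\mathbf E_k\|g^k\|^2\le2A'(f(x^k)-f(x^* ))+B_1'\sigma_{1,k}^2+B_2'\sigma_{2,k}^2+D_1'$; $\mathbf E_k[\sigma_{1,k+1}^2]\le(1-\rho_1)\sigma_{1,k}^2+2C_1(f(x^k)-f(x^* ))+G\rho_1\sigma_{2,k}^2+D_2$; $\mathbf E_k[\sigma_{2,k+1}^2]\le(1-\rho_2)\sigma_{2,k}^2+2C_2(f(x^k)-f(x^* ))$; $3L\sum_{k=0}^Kw_k\mathbf E\|e^k\|^2\le\frac14\sum_{k=0}^Kw_k\mathbf E[f(x^k)-f(x^* )]+F_1\sigma_{1,0}^2+F_2\sigma_{2,0}^2+\gamma D_3W_K$, where $w_k=(1-\eta)^{-(k+1)}$, $W_K=\sum_{k=0}^Kw_k$, $\eta=\min\{\frac{\gamma\mu}2,\frac{\rho_1}4,\frac{\rho_2}4\}$. Also $\bar x^K=\frac1{W_K}\sum_{k=0}^Kw_kx^k$.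 *)

theory Defs
  imports "HOL-Probability.Probability"
begin

definition grad :: "('a::euclidean_space \<Rightarrow> real) \<Rightarrow> 'a \<Rightarrow> 'a" where
  "grad h x = (THE D. GDERIV h x :> D)"

definition smooth_fun :: "real \<Rightarrow> ('a::euclidean_space \<Rightarrow> real) \<Rightarrow> bool" where
  "smooth_fun L h \<longleftrightarrow> (\<forall>x. h differentiable (at x)) \<and> L-lipschitz_on UNIV (grad h)"

definition quasi_strongly_convex :: "real \<Rightarrow> ('a::euclidean_space \<Rightarrow> real) \<Rightarrow> 'a \<Rightarrow> bool" where
  "quasi_strongly_convex \<mu> h xs \<longleftrightarrow>
     (\<forall>x. h xs \<le> h x) \<and> (\<forall>y. (\<forall>x. h y \<le> h x) \<longrightarrow> y = xs) \<and>
     (\<forall>x. h xs \<ge> h x + grad h x \<bullet> (xs - x) + \<mu> / 2 * (norm (x - xs))\<^sup>2)"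

definition bregman :: "('a::euclidean_space \<Rightarrow> real) \<Rightarrow> 'a \<Rightarrow> 'a \<Rightarrow> real" where
  "bregman h x y = h x - h y - grad h y \<bullet> (x - y)"

text \<open>
  The component functions are given as \<open>F i j\<close>. Workers and local data points are indexed by
  finite types, so that the numbers of workers and of points per worker are
  \<^term>\<open>CARD('n)\<close> and \<^term>\<open>CARD('m)\<close>.
\<close>

definition local_loss :: "('n \<Rightarrow> 'm::finite \<Rightarrow> 'a \<Rightarrow> real) \<Rightarrow> 'n \<Rightarrow> 'a \<Rightarrow> real" where
  "local_loss F i x = (1 / real CARD('m)) * (\<Sum>j\<in>UNIV. F i j x)"

definition global_loss :: "('n::finite \<Rightarrow> 'm::finite \<Rightarrow> 'a \<Rightarrow> real) \<Rightarrow> 'a \<Rightarrow> real" where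
  "global_loss F x = (1 / real CARD('n)) * (\<Sum>i\<in>UNIV. local_loss F i x)"

definition sampled_loss ::
    "('n \<Rightarrow> 'm::finite \<Rightarrow> 'a \<Rightarrow> real) \<Rightarrow> 'n \<Rightarrow> real^'m \<Rightarrow> 'a \<Rightarrow> real" where
  "sampled_loss F i z x = (1 / real CARD('m)) * (\<Sum>j\<in>UNIV. z $ j * F i j x)"

definition sampling_distribution :: "(real^'m::finite) measure \<Rightarrow> bool" where
  "sampling_distribution D \<longleftrightarrow> prob_space D \<and> sets D = sets borel \<and>
     (\<forall>j. integrable D (\<lambda>z. z $ j) \<and> (LINT z|D. z $ j) = 1)"

text \<open>
  Here and below, a (conditional) expectation is always accompanied by an integrability
  requirement, because the Bochner integral of a non-integrable function is 0.
\<close>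

definition expected_smoothness ::
    "('n::finite \<Rightarrow> 'm::finite \<Rightarrow> 'a::euclidean_space \<Rightarrow> real) \<Rightarrow> ('n \<Rightarrow> (real^'m) measure) \<Rightarrow>
     real \<Rightarrow> 'a \<Rightarrow> bool" where
  "expected_smoothness F D \<L> xs \<longleftrightarrow> (\<forall>i x.
     integrable (D i)
       (\<lambda>z. (norm (grad (sampled_loss F i z) x - grad (sampled_loss F i z) xs))\<^sup>2) \<and>
     (LINT z|D i. (norm (grad (sampled_loss F i z) x - grad (sampled_loss F i z) xs))\<^sup>2)
       \<le> 2 * \<L> * bregman (local_loss F i) x xs)"

definition noise_sq ::
    "('n \<Rightarrow> 'm::finite \<Rightarrow> 'a::euclidean_space \<Rightarrow> real) \<Rightarrow> 'a \<Rightarrow> 'n \<Rightarrow> real^'m \<Rightarrow> real" where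
  "noise_sq F xs i z = (norm (grad (sampled_loss F i z) xs - grad (local_loss F i) xs))\<^sup>2"

text \<open>
  A randomized operator is represented by a function \<open>q x u\<close> of the input \<open>x\<close> and a random
  seed \<open>u\<close> distributed according to \<open>P\<close>; fresh randomness means an independent seed.
\<close>

definition quantization ::
    "real \<Rightarrow> 'u measure \<Rightarrow> ('a::euclidean_space \<Rightarrow> 'u \<Rightarrow> 'a) \<Rightarrow> bool" where
  "quantization \<omega> P q \<longleftrightarrow> prob_space P \<and>
     (\<lambda>(x, u). q x u) \<in> borel_measurable (borel \<Otimes>\<^sub>M P) \<and>
     (\<forall>x. integrable P (q x) \<and> (LINT u|P. q x u) = x \<and>
          integrable P (\<lambda>u. (norm (q x u - x))\<^sup>2) \<and>
          (LINT u|P. (norm (q x u - x))\<^sup>2) \<le> \<omega> * (norm x)\<^sup>2)"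

text \<open>
  At iteration \<open>k\<close>, worker \<open>i\<close> draws a sampling vector and a seed for the worker-side
  quantizer, and the master draws one seed for its own quantizer.
\<close>

datatype 'n source = Sample nat 'n | Worker_Seed nat 'n | Master_Seed nat

fun iteration :: "'n source \<Rightarrow> nat" where
  "iteration (Sample k i) = k"
| "iteration (Worker_Seed k i) = k"
| "iteration (Master_Seed k) = k"

fun source_events ::
    "'w measure \<Rightarrow> (nat \<Rightarrow> 'n \<Rightarrow> 'w \<Rightarrow> real^'m::finite) \<Rightarrow>
     'u measure \<Rightarrow> (nat \<Rightarrow> 'n \<Rightarrow> 'w \<Rightarrow> 'u) \<Rightarrow> 'v measure \<Rightarrow> (nat \<Rightarrow> 'w \<Rightarrow> 'v) \<Rightarrow>
     'n source \<Rightarrow> 'w set set" where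
  "source_events M \<xi> P1 U1 P2 U2 (Sample k i) = {\<xi> k i -` A \<inter> space M | A. A \<in> sets borel}"
| "source_events M \<xi> P1 U1 P2 U2 (Worker_Seed k i) = {U1 k i -` A \<inter> space M | A. A \<in> sets P1}"
| "source_events M \<xi> P1 U1 P2 U2 (Master_Seed k) = {U2 k -` A \<inter> space M | A. A \<in> sets P2}"

definition fresh_randomness ::
    "'w measure \<Rightarrow> ('n::finite \<Rightarrow> (real^'m::finite) measure) \<Rightarrow> (nat \<Rightarrow> 'n \<Rightarrow> 'w \<Rightarrow> real^'m) \<Rightarrow>
     'u measure \<Rightarrow> (nat \<Rightarrow> 'n \<Rightarrow> 'w \<Rightarrow> 'u) \<Rightarrow> 'v measure \<Rightarrow> (nat \<Rightarrow> 'w \<Rightarrow> 'v) \<Rightarrow> bool" where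
  "fresh_randomness M D \<xi> P1 U1 P2 U2 \<longleftrightarrow> prob_space M \<and>
     (\<forall>k i. \<xi> k i \<in> borel_measurable M \<and> distr M borel (\<xi> k i) = D i) \<and>
     (\<forall>k i. U1 k i \<in> measurable M P1 \<and> distr M P1 (U1 k i) = P1) \<and>
     (\<forall>k. U2 k \<in> measurable M P2 \<and> distr M P2 (U2 k) = P2) \<and>
     prob_space.indep_sets M (source_events M \<xi> P1 U1 P2 U2) UNIV"

definition past ::
    "'w measure \<Rightarrow> (nat \<Rightarrow> 'n \<Rightarrow> 'w \<Rightarrow> real^'m::finite) \<Rightarrow>
     'u measure \<Rightarrow> (nat \<Rightarrow> 'n \<Rightarrow> 'w \<Rightarrow> 'u) \<Rightarrow> 'v measure \<Rightarrow> (nat \<Rightarrow> 'w \<Rightarrow> 'v) \<Rightarrow>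
     nat \<Rightarrow> 'w measure" where
  "past M \<xi> P1 U1 P2 U2 k =
     sigma (space M) (\<Union>s\<in>{s. iteration s < k}. source_events M \<xi> P1 U1 P2 U2 s)"

definition dianasr_dq_run ::
    "('n::finite \<Rightarrow> 'm::finite \<Rightarrow> 'a::euclidean_space \<Rightarrow> real) \<Rightarrow> real \<Rightarrow> real \<Rightarrow> 'a \<Rightarrow> ('n \<Rightarrow> 'a) \<Rightarrow>
     ('a \<Rightarrow> 'u \<Rightarrow> 'a) \<Rightarrow> ('a \<Rightarrow> 'v \<Rightarrow> 'a) \<Rightarrow> 'w measure \<Rightarrow>
     (nat \<Rightarrow> 'n \<Rightarrow> 'w \<Rightarrow> real^'m) \<Rightarrow> (nat \<Rightarrow> 'n \<Rightarrow> 'w \<Rightarrow> 'u) \<Rightarrow> (nat \<Rightarrow> 'w \<Rightarrow> 'v) \<Rightarrow>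
     (nat \<Rightarrow> 'w \<Rightarrow> 'a) \<Rightarrow> (nat \<Rightarrow> 'n \<Rightarrow> 'w \<Rightarrow> 'a) \<Rightarrow> (nat \<Rightarrow> 'n \<Rightarrow> 'w \<Rightarrow> 'a) \<Rightarrow>
     (nat \<Rightarrow> 'w \<Rightarrow> 'a) \<Rightarrow> (nat \<Rightarrow> 'w \<Rightarrow> 'a) \<Rightarrow> bool" where
  "dianasr_dq_run F \<gamma> \<alpha> x0 h0 q1 q2 M \<xi> U1 U2 x h \<Delta> g2 g \<longleftrightarrow> (\<forall>w\<in>space M.
     x 0 w = x0 \<and> (\<forall>i. h 0 i w = h0 i) \<and>
     (\<forall>k.
       (\<forall>i. \<Delta> k i w = q1 (grad (sampled_loss F i (\<xi> k i w)) (x k w) - h k i w) (U1 k i w)) \<and>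
       (\<forall>i. h (Suc k) i w = h k i w + \<alpha> *\<^sub>R \<Delta> k i w) \<and>
       g2 k w = (1 / real CARD('n)) *\<^sub>R (\<Sum>i\<in>UNIV. h k i w + \<Delta> k i w) \<and>
       g k w = q2 (g2 k w) (U2 k w) \<and>
       x (Suc k) w = x k w - \<gamma> *\<^sub>R g k w))"

definition shift_dist_sq ::
    "('n::finite \<Rightarrow> 'm::finite \<Rightarrow> 'a::euclidean_space \<Rightarrow> real) \<Rightarrow> 'a \<Rightarrow> ('n \<Rightarrow> 'a) \<Rightarrow> real" where
  "shift_dist_sq F xs H =
     (1 / real CARD('n)) * (\<Sum>i\<in>UNIV. (norm (H i - grad (local_loss F i) xs))\<^sup>2)"

definition cond_exp_vec ::
    "'w measure \<Rightarrow> 'w measure \<Rightarrow> ('w \<Rightarrow> 'a::euclidean_space) \<Rightarrow> 'w \<Rightarrow> 'a" where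
  "cond_exp_vec M N X w = (\<Sum>b\<in>Basis. real_cond_exp M N (\<lambda>w. X w \<bullet> b) w *\<^sub>R b)"

definition weight :: "real \<Rightarrow> nat \<Rightarrow> real" where
  "weight \<eta> k = 1 / (1 - \<eta>) ^ (k + 1)"

definition weight_sum :: "real \<Rightarrow> nat \<Rightarrow> real" where
  "weight_sum \<eta> K = (\<Sum>k\<le>K. weight \<eta> k)"

definition weighted_avg :: "real \<Rightarrow> (nat \<Rightarrow> 'w \<Rightarrow> 'a::real_vector) \<Rightarrow> nat \<Rightarrow> 'w \<Rightarrow> 'a" where
  "weighted_avg \<eta> x K w = (1 / weight_sum \<eta> K) *\<^sub>R (\<Sum>k\<le>K. weight \<eta> k *\<^sub>R x k w)"

definition rate :: "real \<Rightarrow> real \<Rightarrow> real \<Rightarrow> real \<Rightarrow> real" where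
  "rate \<gamma> \<mu> \<rho>1 \<rho>2 = min (\<gamma> * \<mu> / 2) (min (\<rho>1 / 4) (\<rho>2 / 4))"

text \<open>
  The processes \<open>s1\<close> and \<open>s2\<close> stand for the already squared quantities
  \<open>\<sigma>\<^sub>1\<^sup>2\<close> and \<open>\<sigma>\<^sub>2\<^sup>2\<close>; \<open>N k\<close> is the \<open>\<sigma>\<close>-algebra conditioned on at
  iteration \<open>k\<close>, and \<open>e\<close> is the sequence of error-feedback vectors.
\<close>

definition parametric_assumption ::
    "'w measure \<Rightarrow> (nat \<Rightarrow> 'w measure) \<Rightarrow> ('a::euclidean_space \<Rightarrow> real) \<Rightarrow> 'a \<Rightarrow>
     real \<Rightarrow> real \<Rightarrow> real \<Rightarrow>
     (nat \<Rightarrow> 'w \<Rightarrow> 'a) \<Rightarrow> (nat \<Rightarrow> 'w \<Rightarrow> 'a) \<Rightarrow> (nat \<Rightarrow> 'w \<Rightarrow> 'a) \<Rightarrow>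
     (nat \<Rightarrow> 'w \<Rightarrow> real) \<Rightarrow> (nat \<Rightarrow> 'w \<Rightarrow> real) \<Rightarrow>
     real \<Rightarrow> real \<Rightarrow> real \<Rightarrow> real \<Rightarrow> real \<Rightarrow> real \<Rightarrow> real \<Rightarrow> real \<Rightarrow> real \<Rightarrow> real \<Rightarrow> real \<Rightarrow>
     real \<Rightarrow> real \<Rightarrow> bool" where
  "parametric_assumption M N f xs L \<gamma> \<mu> x g e s1 s2 A' B1' B2' D1' \<rho>1 \<rho>2 C1 C2 G D2 D3 F1 F2 \<longleftrightarrow>
     (\<forall>k. integrable M (g k) \<and>
       integrable M (\<lambda>w. (norm (g k w))\<^sup>2) \<and>
       integrable M (\<lambda>w. f (x k w) - f xs) \<and>
       integrable M (\<lambda>w. (norm (e k w))\<^sup>2) \<and>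
       integrable M (s1 k) \<and> integrable M (s2 k)) \<and>
     (\<forall>k. AE w in M. cond_exp_vec M (N k) (g k) w = grad f (x k w)) \<and>
     (\<forall>k. AE w in M. real_cond_exp M (N k) (\<lambda>w. (norm (g k w))\<^sup>2) w
        \<le> 2 * A' * (f (x k w) - f xs) + B1' * s1 k w + B2' * s2 k w + D1') \<and>
     (\<forall>k. AE w in M. real_cond_exp M (N k) (s1 (Suc k)) w
        \<le> (1 - \<rho>1) * s1 k w + 2 * C1 * (f (x k w) - f xs) + G * \<rho>1 * s2 k w + D2) \<and>
     (\<forall>k. AE w in M. real_cond_exp M (N k) (s2 (Suc k)) w
        \<le> (1 - \<rho>2) * s2 k w + 2 * C2 * (f (x k w) - f xs)) \<and>
     (let \<eta> = rate \<gamma> \<mu> \<rho>1 \<rho>2 in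
      \<forall>K. AE w in M.
        3 * L * (\<Sum>k\<le>K. weight \<eta> k * (LINT w|M. (norm (e k w))\<^sup>2))
        \<le> 1 / 4 * (\<Sum>k\<le>K. weight \<eta> k * (LINT w|M. f (x k w) - f xs))
          + F1 * s1 0 w + F2 * s2 0 w + \<gamma> * D3 * weight_sum \<eta> K)"

end

theory Submission
  imports Defs
begin

text \<open>
  The proof rests on one probabilistic principle and on elementary inequalities.

  \<^bold>\<open>Fresh noise is orthogonal to the past.\<close> If a seed is independent of a \<open>\<sigma>\<close>-algebra \<open>N\<close>, then an
  \<open>N\<close>-measurable vector and a noise term that is centred under that seed have expected inner
  product zero (\<open>integral_inner_centred\<close>). One iteration adds, in this order, the sampling noise of
  every worker, the error of every worker-side quantizer and the error of the master's quantizer,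
  and each is centred given everything before it. Hence the cross terms between them vanish:
  the master multiplies the second moment of its input by at most \<open>1 + \<omega>2\<close>, the worker
  errors contribute the average of their variances divided by \<open>n\<close>, and so does the sampling noise at
  the minimizer.
  Conditional statements are proved in integrated form, as inequalities between
  expectations restricted to an arbitrary event \<open>A\<close> of the past, and become conditional
  expectations only at the end (\<open>real_cond_exp_leI\<close>).

  \<^bold>\<open>The two moment bounds.\<close> The stochastic gradient splits into its
  distance to the stochastic gradient at the minimizer, which expected smoothness bounds by a Bregman
  divergence, and the noise at the minimizer. The Bregman divergences of the local
  losses sum to \<open>n\<close> times the optimality gap, since the local gradients at the minimizer sum to zero.
  This gives the bound on \<open>g\<close> (\<open>g_second_moment\<close>). For the shifts, \<open>\<alpha> (1 + \<omega>1) \<le> 1\<close> makes the second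
  moment of the new shift at most a convex combination of that of the old shift
  and that of the stochastic gradient (\<open>shift_step_pointwise\<close>, \<open>shift_second_moment\<close>).
  Square integrability of all iterates, on which every one of these integrals depends, follows by
  induction along the run (\<open>state_si\<close>).

  \<^bold>\<open>The rate.\<close> The Lyapunov function, expected squared distance to the minimizer plus \<open>M1 \<gamma>\<^sup>2\<close> times
  the expected mean squared distance of the shifts to the local gradients at the minimizer, contracts by
  \<open>1 - \<eta>\<close> up to a constant and pays \<open>3/2 \<gamma>\<close> times the gap (\<open>lyapunov_step\<close>). With the
  weights \<open>(1 - \<eta>)\<close> to the power \<open>-(k + 1)\<close> the inequalities telescope, and convexity of \<open>f\<close>
  transfers the weighted mean of the gaps to the averaged iterate.
\<close>

section \<open>Gradients\<close>

lemma grad_eqI: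
  fixes h :: "'a::euclidean_space \<Rightarrow> real"
  assumes "GDERIV h x :> D"
  shows "grad h x = D"
  unfolding grad_def
proof (rule the_equality)
  fix D' assume "GDERIV h x :> D'"
  with assms have "(\<lambda>v. v \<bullet> D') = (\<lambda>v. v \<bullet> D)"
    unfolding gderiv_def by (metis has_derivative_unique)
  then show "D' = D"
    by (metis vector_eq_ldot)
qed (fact assms)

lemma GDERIV_grad:
  fixes h :: "'a::euclidean_space \<Rightarrow> real"
  assumes "h differentiable (at x)"
  shows "GDERIV h x :> grad h x"
proof -
  obtain h' where h': "(h has_derivative h') (at x)"
    using assms unfolding differentiable_def by blast
  interpret linear h' by (rule has_derivative_linear[OF h'])
  have "h' = (\<lambda>v. v \<bullet> (\<Sum>b\<in>Basis. h' b *\<^sub>R b))"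
  proof
    fix v
    have "h' v = h' (\<Sum>b\<in>Basis. (v \<bullet> b) *\<^sub>R b)"
      by (simp add: euclidean_representation)
    also have "\<dots> = (\<Sum>b\<in>Basis. (v \<bullet> b) * h' b)"
      by (simp add: sum scale)
    finally show "h' v = v \<bullet> (\<Sum>b\<in>Basis. h' b *\<^sub>R b)"
      by (simp add: inner_sum_right mult.commute)
  qed
  then have "GDERIV h x :> (\<Sum>b\<in>Basis. h' b *\<^sub>R b)"
    using h' unfolding gderiv_def by metis
  with grad_eqI show ?thesis by metis
qed

lemma grad_weighted_sum:
  fixes f :: "'j \<Rightarrow> 'a::euclidean_space \<Rightarrow> real"
  assumes "\<And>j. j \<in> J \<Longrightarrow> f j differentiable (at x)"
  shows "grad (\<lambda>y. c * (\<Sum>j\<in>J. a j * f j y)) x = c *\<^sub>R (\<Sum>j\<in>J. a j *\<^sub>R grad (f j) x)"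
proof (rule grad_eqI)
  have d: "(f j has_derivative (\<lambda>v. v \<bullet> grad (f j) x)) (at x)" if "j \<in> J" for j
    using GDERIV_grad[OF assms[OF that]] unfolding gderiv_def .
  have "((\<lambda>y. c * (\<Sum>j\<in>J. a j * f j y)) has_derivative
      (\<lambda>v. c * (\<Sum>j\<in>J. a j * (v \<bullet> grad (f j) x)))) (at x)"
    by (intro has_derivative_mult_right has_derivative_sum d)
  then show "GDERIV (\<lambda>y. c * (\<Sum>j\<in>J. a j * f j y)) x :> c *\<^sub>R (\<Sum>j\<in>J. a j *\<^sub>R grad (f j) x)"
    unfolding gderiv_def by (simp add: inner_sum_right)
qed

lemma directional_difference_quotient:
  fixes h :: "'a::euclidean_space \<Rightarrow> real"
  assumes "h differentiable (at x)"
  shows "((\<lambda>t. (h (x + t *\<^sub>R v) - h x) / t) \<longlongrightarrow> grad h x \<bullet> v) (at 0)"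
proof -
  have d: "(h has_derivative (\<lambda>v. v \<bullet> grad h x)) (at (x + 0 *\<^sub>R v))"
    using GDERIV_grad[OF assms] unfolding gderiv_def by simp
  have l: "((\<lambda>t::real. x + t *\<^sub>R v) has_derivative (\<lambda>t. t *\<^sub>R v)) (at 0)"
    by (auto intro!: derivative_eq_intros)
  have "((\<lambda>t::real. h (x + t *\<^sub>R v)) has_derivative (\<lambda>t. (t *\<^sub>R v) \<bullet> grad h x)) (at 0)"
    using has_derivative_compose[OF l d] .
  then have "((\<lambda>t::real. h (x + t *\<^sub>R v)) has_field_derivative (grad h x \<bullet> v)) (at 0)"
    unfolding has_field_derivative_def
    by (rule has_derivative_eq_rhs) (auto simp: inner_commute)
  then show ?thesis
    unfolding has_field_derivative_iff by simp
qed

text \<open>Each directional derivative is a pointwise limit of difference quotients of a continuous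
  function.\<close>
lemma borel_measurable_grad:
  fixes h :: "'a::euclidean_space \<Rightarrow> real"
  assumes "\<And>x. h differentiable (at x)"
  shows "grad h \<in> borel_measurable borel"
proof -
  have "continuous_on UNIV h"
    using assms by (simp add: continuous_on_eq_continuous_at differentiable_imp_continuous_within)
  then have [measurable]: "h \<in> borel_measurable borel"
    by (rule borel_measurable_continuous_onI)
  have "(\<lambda>x. grad h x \<bullet> b) \<in> borel_measurable borel" if "b \<in> Basis" for b
  proof (rule borel_measurable_LIMSEQ_real)
    fix x
    have "filterlim (\<lambda>n. 1 / real (Suc n)) (at 0) sequentially"
      unfolding filterlim_at using LIMSEQ_inverse_real_of_nat
      by (auto simp: inverse_eq_divide)
    from filterlim_compose[OF directional_difference_quotient[OF assms] this]
    show "(\<lambda>n. (h (x + (1 / real (Suc n)) *\<^sub>R b) - h x) / (1 / real (Suc n)))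
        \<longlonglongrightarrow> grad h x \<bullet> b" .
  next
    fix n
    show "(\<lambda>x. (h (x + (1 / real (Suc n)) *\<^sub>R b) - h x) / (1 / real (Suc n))) \<in> borel_measurable borel"
      by measurable
  qed
  then show ?thesis
    using borel_measurable_euclidean_space[of "grad h" borel] by auto
qed

text \<open>Along the segment from \<open>y\<close> to \<open>x\<close> the difference quotients of a convex function are bounded
  by the full increment; the directional derivative is their limit.\<close>
lemma bregman_nonneg:
  fixes h :: "'a::euclidean_space \<Rightarrow> real"
  assumes "convex_on UNIV h" and "h differentiable (at y)"
  shows "0 \<le> bregman h x y"
proof -
  have lim: "((\<lambda>t. (h (y + t *\<^sub>R (x - y)) - h y) / t) \<longlongrightarrow> grad h y \<bullet> (x - y)) (at_right 0)"
    using directional_difference_quotient[OF assms(2)] by (rule filterlim_mono) (auto simp: at_le)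
  have "\<forall>\<^sub>F t in at_right (0::real). (h (y + t *\<^sub>R (x - y)) - h y) / t \<le> h x - h y"
  proof (rule eventually_at_rightI[of 0 1])
    fix t :: real assume t: "t \<in> {0<..<1}"
    have "h ((1 - t) *\<^sub>R y + t *\<^sub>R x) \<le> (1 - t) * h y + t * h x"
      using t by (intro convex_onD[OF assms(1)]) auto
    also have "(1 - t) *\<^sub>R y + t *\<^sub>R x = y + t *\<^sub>R (x - y)"
      by (simp add: algebra_simps)
    finally show "(h (y + t *\<^sub>R (x - y)) - h y) / t \<le> h x - h y"
      using t by (simp add: field_simps)
  qed simp
  from tendsto_upperbound[OF lim this] show ?thesis
    unfolding bregman_def by simp
qed

lemma grad_at_minimizer:
  fixes h :: "'a::euclidean_space \<Rightarrow> real"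
  assumes "h differentiable (at x)" and "\<And>y. h x \<le> h y"
  shows "grad h x = 0"
proof -
  have "(\<lambda>v. v \<bullet> grad h x) = (\<lambda>v. 0)"
    using GDERIV_grad[OF assms(1)] assms(2) unfolding gderiv_def
    by (intro has_derivative_local_min) auto
  then show ?thesis by (metis inner_eq_zero_iff)
qed

section \<open>Square-integrable random vectors\<close>

definition square_integrable :: "'w measure \<Rightarrow> ('w \<Rightarrow> 'a::euclidean_space) \<Rightarrow> bool" where
  "square_integrable M X \<longleftrightarrow> X \<in> borel_measurable M \<and> integrable M (\<lambda>w. (norm (X w))\<^sup>2)"

lemma square_integrableI:
  "X \<in> borel_measurable M \<Longrightarrow> integrable M (\<lambda>w. (norm (X w))\<^sup>2) \<Longrightarrow> square_integrable M X"
  by (simp add: square_integrable_def)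

lemma square_integrable_measurable:
  "square_integrable M X \<Longrightarrow> X \<in> borel_measurable M"
  by (simp add: square_integrable_def)

lemma square_integrable_norm:
  "square_integrable M X \<Longrightarrow> integrable M (\<lambda>w. (norm (X w))\<^sup>2)"
  by (simp add: square_integrable_def)

lemma square_integrable_bound:
  assumes "X \<in> borel_measurable M" "integrable M B" "\<And>w. w \<in> space M \<Longrightarrow> (norm (X w))\<^sup>2 \<le> B w"
  shows "square_integrable M X"
proof (rule square_integrableI)
  note [measurable] = assms(1)
  show "integrable M (\<lambda>w. (norm (X w))\<^sup>2)"
    using assms(3) by (intro Bochner_Integration.integrable_bound[OF assms(2)])
      (auto intro!: AE_I2 intro: order_trans[OF _ abs_ge_self])
qed (fact assms(1))

lemma norm_sum_sq_le2:
  fixes a b :: "'a::real_inner"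
  shows "(norm (a + b))\<^sup>2 \<le> 2 * (norm a)\<^sup>2 + 2 * (norm b)\<^sup>2"
proof -
  have "(norm (a + b))\<^sup>2 + (norm (a - b))\<^sup>2 = 2 * (norm a)\<^sup>2 + 2 * (norm b)\<^sup>2"
    by (simp add: power2_norm_eq_inner inner_add inner_diff inner_commute)
  then show ?thesis by (smt (verit) zero_le_power2)
qed

lemma norm_sum_sq_le3:
  fixes a b c :: "'a::real_inner"
  shows "(norm (a + b + c))\<^sup>2 \<le> 3 * ((norm a)\<^sup>2 + (norm b)\<^sup>2 + (norm c)\<^sup>2)"
proof -
  have "(norm (a + b + c))\<^sup>2 + (norm (a - b))\<^sup>2 + (norm (b - c))\<^sup>2 + (norm (a - c))\<^sup>2
      = 3 * ((norm a)\<^sup>2 + (norm b)\<^sup>2 + (norm c)\<^sup>2)"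
    by (simp add: power2_norm_eq_inner inner_add inner_diff inner_commute)
  then show ?thesis
    using zero_le_power2[of "norm (a - b)"] zero_le_power2[of "norm (b - c)"]
      zero_le_power2[of "norm (a - c)"] by linarith
qed

lemma square_integrable_scaleR:
  assumes "square_integrable M X"
  shows "square_integrable M (\<lambda>w. c *\<^sub>R X w)"
  using assms by (auto simp: square_integrable_def power_mult_distrib)

lemma square_integrable_add:
  assumes "square_integrable M X" "square_integrable M Y"
  shows "square_integrable M (\<lambda>w. X w + Y w)"
proof (rule square_integrable_bound)
  show "integrable M (\<lambda>w. 2 * (norm (X w))\<^sup>2 + 2 * (norm (Y w))\<^sup>2)"
    using assms by (auto simp: square_integrable_def)
  show "(\<lambda>w. X w + Y w) \<in> borel_measurable M"
    using assms by (auto simp: square_integrable_def)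
qed (rule norm_sum_sq_le2)

lemma square_integrable_diff:
  assumes "square_integrable M X" "square_integrable M Y"
  shows "square_integrable M (\<lambda>w. X w - Y w)"
  using square_integrable_add[OF assms(1) square_integrable_scaleR[OF assms(2), of "-1"]] by simp

lemma (in finite_measure) square_integrable_const: "square_integrable M (\<lambda>w. c)"
  by (simp add: square_integrable_def)

lemma square_integrable_sum:
  assumes "\<And>i. i \<in> I \<Longrightarrow> square_integrable M (X i)"
  shows "square_integrable M (\<lambda>w. \<Sum>i\<in>I. X i w)"
  using assms
proof (induction I rule: infinite_finite_induct)
  case (insert i I)
  then show ?case by (simp add: square_integrable_add)
qed (simp_all add: square_integrable_def)

lemma square_integrable_cong:
  assumes "\<And>w. w \<in> space M \<Longrightarrow> X w = Y w"
  shows "square_integrable M X \<longleftrightarrow> square_integrable M Y"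
proof -
  have "X \<in> borel_measurable M \<longleftrightarrow> Y \<in> borel_measurable M"
    using assms by (rule measurable_cong)
  moreover have "integrable M (\<lambda>w. (norm (X w))\<^sup>2) \<longleftrightarrow> integrable M (\<lambda>w. (norm (Y w))\<^sup>2)"
    using assms by (intro Bochner_Integration.integrable_cong) auto
  ultimately show ?thesis
    by (simp add: square_integrable_def)
qed

lemma square_integrable_indicator:
  assumes "square_integrable M X" "A \<in> sets M"
  shows "square_integrable M (\<lambda>w. indicator A w *\<^sub>R X w)"
proof (rule square_integrable_bound)
  show "integrable M (\<lambda>w. (norm (X w))\<^sup>2)"
    using assms by (simp add: square_integrable_def)
  show "(\<lambda>w. indicator A w *\<^sub>R X w) \<in> borel_measurable M"
    using assms by (auto simp: square_integrable_def)
qed (auto simp: indicator_def)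

lemma square_integrable_inner:
  assumes "square_integrable M X" "square_integrable M Y"
  shows "integrable M (\<lambda>w. X w \<bullet> Y w)"
proof (rule Bochner_Integration.integrable_bound)
  show "integrable M (\<lambda>w. (norm (X w))\<^sup>2 + (norm (Y w))\<^sup>2)"
    using assms by (auto simp: square_integrable_def)
  show "(\<lambda>w. X w \<bullet> Y w) \<in> borel_measurable M"
    using assms by (auto simp: square_integrable_def)
  have "\<bar>X w \<bullet> Y w\<bar> \<le> (norm (X w))\<^sup>2 + (norm (Y w))\<^sup>2" for w
  proof -
    have "\<bar>X w \<bullet> Y w\<bar> \<le> norm (X w) * norm (Y w)" by (rule Cauchy_Schwarz_ineq2)
    also have "\<dots> \<le> 2 * norm (X w) * norm (Y w)" by simp
    also have "\<dots> \<le> (norm (X w))\<^sup>2 + (norm (Y w))\<^sup>2" by (rule sum_squares_bound)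
    finally show ?thesis .
  qed
  then show "AE w in M. norm (X w \<bullet> Y w) \<le> norm ((norm (X w))\<^sup>2 + (norm (Y w))\<^sup>2)"
    by auto
qed

lemma (in finite_measure) square_integrable_integrable:
  assumes "square_integrable M X"
  shows "integrable M X"
proof (rule Bochner_Integration.integrable_bound)
  show "integrable M (\<lambda>w. 1 + (norm (X w))\<^sup>2)"
    using assms by (auto simp: square_integrable_def)
  have "a \<le> 1 + a\<^sup>2" for a :: real
    using sum_squares_bound[of a 1] zero_le_power2[of a] unfolding one_power2 mult_1_right by linarith
  then show "AE w in M. norm (X w) \<le> norm (1 + (norm (X w))\<^sup>2)"
    by auto
qed (use assms in \<open>simp add: square_integrable_def\<close>)

lemma integrable_indicator_times:
  fixes f :: "'w \<Rightarrow> real"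
  assumes "integrable M f" "A \<in> sets M"
  shows "integrable M (\<lambda>w. indicator A w * f w)"
  using integrable_mult_indicator[OF assms(2,1)] by simp

text \<open>Expectation restricted to an event. Letting \<open>A\<close> range over a \<open>\<sigma>\<close>-algebra, it carries the same
  information as the conditional expectation, without exceptional null sets.\<close>
abbreviation (input) expect_on :: "'w measure \<Rightarrow> 'w set \<Rightarrow> ('w \<Rightarrow> real) \<Rightarrow> real" where
  "expect_on M A X \<equiv> (LINT w|M. indicator A w * X w)"

lemma expect_on_add:
  assumes "integrable M X" "integrable M Y" "A \<in> sets M"
  shows "expect_on M A (\<lambda>w. X w + Y w) = expect_on M A X + expect_on M A Y"
  using assms by (simp add: distrib_left integrable_indicator_times)

lemma expect_on_cmult: "expect_on M A (\<lambda>w. c * X w) = c * expect_on M A X"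
  by (simp add: mult.left_commute[of _ c])

lemma expect_on_sum:
  assumes "\<And>i. i \<in> I \<Longrightarrow> integrable M (X i)" "A \<in> sets M"
  shows "expect_on M A (\<lambda>w. \<Sum>i\<in>I. X i w) = (\<Sum>i\<in>I. expect_on M A (X i))"
  using assms by (simp add: sum_distrib_left integrable_indicator_times)

lemma expect_on_mono:
  assumes "integrable M X" "integrable M Y" "A \<in> sets M" "\<And>w. w \<in> space M \<Longrightarrow> X w \<le> Y w"
  shows "expect_on M A X \<le> expect_on M A Y"
  using assms by (intro integral_mono integrable_indicator_times) (auto intro: mult_left_mono)

lemma expect_on_cong:
  assumes "\<And>w. w \<in> space M \<Longrightarrow> X w = Y w"
  shows "expect_on M A X = expect_on M A Y"
  using assms by (intro Bochner_Integration.integral_cong) auto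

lemma expect_on_space: "expect_on M (space M) X = (LINT w|M. X w)"
  by (intro Bochner_Integration.integral_cong) auto

lemma integral_norm_sq_add_orthogonal:
  assumes X: "square_integrable M X" and Y: "square_integrable M Y" and A: "A \<in> sets M"
    and orth: "(LINT w|M. (indicator A w *\<^sub>R X w) \<bullet> Y w) = 0"
  shows "expect_on M A (\<lambda>w. (norm (X w + Y w))\<^sup>2) =
    expect_on M A (\<lambda>w. (norm (X w))\<^sup>2) + expect_on M A (\<lambda>w. (norm (Y w))\<^sup>2)"
proof -
  have "indicator A w * (norm (X w + Y w))\<^sup>2 = indicator A w * (norm (X w))\<^sup>2
      + indicator A w * (norm (Y w))\<^sup>2 + 2 * ((indicator A w *\<^sub>R X w) \<bullet> Y w)" for w
    by (simp add: power2_norm_eq_inner algebra_simps inner_commute)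
  then show ?thesis
    using orth integrable_indicator_times[OF square_integrable_norm[OF X] A]
      integrable_indicator_times[OF square_integrable_norm[OF Y] A]
      square_integrable_inner[OF square_integrable_indicator[OF X A] Y]
    by simp
qed

lemma integral_norm_sq_sum_orthogonal:
  assumes X: "\<And>i. i \<in> I \<Longrightarrow> square_integrable M (X i)" and A: "A \<in> sets M" and "finite I"
    and orth: "\<And>i j. i \<in> I \<Longrightarrow> j \<in> I \<Longrightarrow> i \<noteq> j \<Longrightarrow> (LINT w|M. (indicator A w *\<^sub>R X i w) \<bullet> X j w) = 0"
  shows "expect_on M A (\<lambda>w. (norm (\<Sum>i\<in>I. X i w))\<^sup>2) =
    (\<Sum>i\<in>I. expect_on M A (\<lambda>w. (norm (X i w))\<^sup>2))"
  using \<open>finite I\<close> X orth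
proof (induction I)
  case (insert i I)
  have S: "square_integrable M (\<lambda>w. \<Sum>j\<in>I. X j w)"
    using insert by (intro square_integrable_sum) auto
  have "(LINT w|M. (indicator A w *\<^sub>R X i w) \<bullet> (\<Sum>j\<in>I. X j w)) =
      (\<Sum>j\<in>I. LINT w|M. (indicator A w *\<^sub>R X i w) \<bullet> X j w)"
    unfolding inner_sum_right
    using insert.prems A
    by (intro Bochner_Integration.integral_sum square_integrable_inner square_integrable_indicator) auto
  also have "\<dots> = 0"
    using insert by (intro sum.neutral) auto
  finally show ?case
    using insert integral_norm_sq_add_orthogonal[OF _ S A, of "X i"] by simp
qed simp

lemma norm_mean_sq_le:
  fixes v :: "'i \<Rightarrow> 'a::real_normed_vector"
  assumes "finite I" "I \<noteq> {}"
  shows "(norm ((1 / real (card I)) *\<^sub>R (\<Sum>i\<in>I. v i)))\<^sup>2 \<le> (1 / real (card I)) * (\<Sum>i\<in>I. (norm (v i))\<^sup>2)"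
proof -
  have c: "real (card I) > 0" using assms by (simp add: card_gt_0_iff)
  have "norm (\<Sum>i\<in>I. v i) \<le> (\<Sum>i\<in>I. norm (v i))" by (rule norm_sum)
  then have "(norm (\<Sum>i\<in>I. v i))\<^sup>2 \<le> (\<Sum>i\<in>I. norm (v i))\<^sup>2" by (intro power_mono) auto
  also have "\<dots> \<le> real (card I) * (\<Sum>i\<in>I. (norm (v i))\<^sup>2)"
    using sum_squared_le_sum_of_squares[of "\<lambda>i. norm (v i)" I] by (simp add: mult.commute)
  finally show ?thesis
    using c by (simp add: power_mult_distrib power2_eq_square field_simps)
qed

section \<open>Fresh randomness\<close>

text \<open>Test the integrated inequality with the event on which the conditional expectation exceeds the
  bound.\<close>
lemma real_cond_exp_leI:
  assumes "finite_measure_subalgebra M N"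
    and X: "integrable M X" and Y: "integrable M Y" and YN: "Y \<in> borel_measurable N"
    and le: "\<And>A. A \<in> sets N \<Longrightarrow> expect_on M A X \<le> expect_on M A Y"
  shows "AE w in M. real_cond_exp M N X w \<le> Y w"
proof -
  interpret finite_measure_subalgebra M N by fact
  note [measurable] = YN
  let ?c = "real_cond_exp M N X"
  have sp: "space N = space M" and sub: "sets N \<subseteq> sets M"
    using subalg by (auto simp: subalgebra_def)
  define A where "A = {w \<in> space N. Y w < ?c w}"
  have AN: "A \<in> sets N" unfolding A_def by measurable
  then have AM: "A \<in> sets M" using sub by auto
  have int: "integrable M (\<lambda>w. indicator A w * (?c w - Y w))"
    using real_cond_exp_int(1)[OF X] Y AM by (intro integrable_indicator_times) auto
  have nn: "0 \<le> indicator A w * (?c w - Y w)" for w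
    by (auto simp: A_def indicator_def)
  have "(LINT w|M. indicator A w * (?c w - Y w)) =
      (LINT w|M. indicator A w * ?c w) - (LINT w|M. indicator A w * Y w)"
    using real_cond_exp_int(1)[OF X] Y AM
    by (simp add: right_diff_distrib integrable_indicator_times)
  also have "(LINT w|M. indicator A w * ?c w) = (LINT w|M. indicator A w * X w)"
    using real_cond_exp_intA[OF X AN] by (simp add: set_lebesgue_integral_def)
  finally have "(LINT w|M. indicator A w * (?c w - Y w)) \<le> 0"
    using le[OF AN] by simp
  moreover have "0 \<le> (LINT w|M. indicator A w * (?c w - Y w))"
    using nn by (intro integral_nonneg_AE) auto
  ultimately have "AE w in M. indicator A w * (?c w - Y w) = 0"
    using integral_nonneg_eq_0_iff_AE[OF int] nn by auto
  then show ?thesis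
    using AE_space by eventually_elim (auto simp: A_def sp split: split_indicator_asm)
qed

locale fresh_seed = prob_space M + P: prob_space P
  for M N :: "'w measure" and P :: "'u measure" and Z :: "'w \<Rightarrow> 'u" +
  assumes subalg: "subalgebra M N"
    and Z_measurable [measurable]: "Z \<in> measurable M P"
    and Z_distr: "distr M P Z = P"
    and Z_indep: "\<And>A B. A \<in> sets N \<Longrightarrow> B \<in> sets P \<Longrightarrow>
      prob (A \<inter> (Z -` B \<inter> space M)) = prob A * prob (Z -` B \<inter> space M)"
begin

abbreviation (input) "R \<equiv> restr_to_subalg M N"

lemma sets_N: "A \<in> sets N \<Longrightarrow> A \<in> sets M"
  using subalg by (auto simp: subalgebra_def)

lemma pair_measurable: "(\<lambda>w. (w, Z w)) \<in> measurable M (N \<Otimes>\<^sub>M P)"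
proof (rule measurable_Pair)
  show "(\<lambda>w. w) \<in> measurable M N"
    using measurable_from_subalg[OF subalg measurable_ident] by (simp add: id_def)
qed simp

lemma prob_R: "prob_space R"
  by (rule prob_space_restr_to_subalg[OF subalg prob_space_axioms])

text \<open>Independence is used in this form only: seen together with the history, a fresh seed has
  a product distribution, so that Fubini's theorem integrates it out first.\<close>
lemma joint_distribution: "R \<Otimes>\<^sub>M P = distr M (N \<Otimes>\<^sub>M P) (\<lambda>w. (w, Z w))"
proof (rule pair_measure_eqI)
  interpret R: prob_space R by (rule prob_R)
  show "sigma_finite_measure R" "sigma_finite_measure P" by unfold_locales
  show "sets (R \<Otimes>\<^sub>M P) = sets (distr M (N \<Otimes>\<^sub>M P) (\<lambda>w. (w, Z w)))"
    using sets_pair_measure_cong[OF sets_restr_to_subalg[OF subalg] refl, of P] by simp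
  fix A B assume "A \<in> sets R" and B: "B \<in> sets P"
  then have A: "A \<in> sets N" by (simp add: sets_restr_to_subalg[OF subalg])
  have "emeasure R A * emeasure P B = emeasure M A * emeasure (distr M P Z) B"
    using A by (simp add: emeasure_restr_to_subalg[OF subalg] Z_distr)
  also have "\<dots> = emeasure M A * emeasure M (Z -` B \<inter> space M)"
    using B by (simp add: emeasure_distr)
  also have "\<dots> = emeasure M (A \<inter> (Z -` B \<inter> space M))"
    using Z_indep[OF A B] by (simp add: emeasure_eq_measure ennreal_mult)
  also have "A \<inter> (Z -` B \<inter> space M) = (\<lambda>w. (w, Z w)) -` (A \<times> B) \<inter> space M"
    by auto
  also have "emeasure M \<dots> = emeasure (distr M (N \<Otimes>\<^sub>M P) (\<lambda>w. (w, Z w))) (A \<times> B)"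
    using A B by (intro emeasure_distr[symmetric] pair_measurable) auto
  finally show "emeasure R A * emeasure P B = \<dots>" .
qed

lemma integral_integrate_out:
  fixes \<phi> :: "'w \<times> 'u \<Rightarrow> real"
  assumes \<phi>: "\<phi> \<in> borel_measurable (N \<Otimes>\<^sub>M P)" and int: "integrable M (\<lambda>w. \<phi> (w, Z w))"
  shows "(LINT w|M. \<phi> (w, Z w)) = (LINT w|M. LINT u|P. \<phi> (w, u))"
proof -
  interpret R: prob_space R by (rule prob_R)
  interpret RP: pair_sigma_finite R P ..
  note [measurable] = \<phi>
  have "integrable (R \<Otimes>\<^sub>M P) \<phi>"
    using int integrable_distr_eq[OF pair_measurable \<phi>] by (simp add: joint_distribution)
  from RP.integral_fst'[OF this]
  have "(LINT w|R. LINT u|P. \<phi> (w, u)) = (LINT w|M. \<phi> (w, Z w))"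
    using integral_distr[OF pair_measurable \<phi>] by (simp add: joint_distribution)
  moreover have "(\<lambda>w. LINT u|P. \<phi> (w, u)) \<in> borel_measurable N"
    by measurable
  ultimately show ?thesis
    using integral_subalgebra2[OF subalg, of "\<lambda>w. LINT u|P. \<phi> (w, u)"] by simp
qed

text \<open>Integrability is derived from a bound on the inner integral, as a second-moment condition on a
  quantizer or a sampling scheme is given for each fixed input only.\<close>
lemma integrable_integrate_out:
  fixes \<phi> :: "'w \<times> 'u \<Rightarrow> real"
  assumes \<phi>: "\<phi> \<in> borel_measurable (N \<Otimes>\<^sub>M P)" and nonneg: "\<And>w u. 0 \<le> \<phi> (w, u)"
    and int_u: "\<And>w. w \<in> space M \<Longrightarrow> integrable P (\<lambda>u. \<phi> (w, u))"
    and bound: "\<And>w. w \<in> space M \<Longrightarrow> (LINT u|P. \<phi> (w, u)) \<le> V w"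
    and V: "integrable M V"
  shows "integrable M (\<lambda>w. \<phi> (w, Z w))"
proof -
  interpret R: prob_space R by (rule prob_R)
  interpret RP: pair_sigma_finite R P ..
  note [measurable] = \<phi>
  have meas [measurable]: "(\<lambda>w. LINT u|P. \<phi> (w, u)) \<in> borel_measurable N"
    by measurable
  have 1: "integrable M (\<lambda>w. LINT u|P. \<phi> (w, u))"
  proof (rule Bochner_Integration.integrable_bound[OF V])
    show "(\<lambda>w. LINT u|P. \<phi> (w, u)) \<in> borel_measurable M"
      by (rule measurable_from_subalg[OF subalg meas])
    show "AE w in M. norm (LINT u|P. \<phi> (w, u)) \<le> norm (V w)"
      using bound nonneg by (intro AE_I2) (force simp: integral_nonneg_AE)
  qed
  have "integrable (R \<Otimes>\<^sub>M P) \<phi>"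
  proof (rule RP.Fubini_integrable)
    show "\<phi> \<in> borel_measurable (R \<Otimes>\<^sub>M P)"
      using \<phi> measurable_cong_sets[OF sets_pair_measure_cong[OF sets_restr_to_subalg[OF subalg] refl] refl]
      by blast
    show "integrable R (\<lambda>w. LINT u|P. norm (\<phi> (w, u)))"
      using 1 meas nonneg by (simp add: integrable_in_subalg[OF subalg])
    show "AE w in R. integrable P (\<lambda>u. \<phi> (w, u))"
      using int_u by (intro AE_I2) (simp add: space_restr_to_subalg)
  qed
  then show ?thesis
    using integrable_distr_eq[OF pair_measurable \<phi>] by (simp add: joint_distribution)
qed

lemma expect_on_bound:
  fixes \<phi> :: "'w \<times> 'u \<Rightarrow> real"
  assumes \<phi>: "\<phi> \<in> borel_measurable (N \<Otimes>\<^sub>M P)" and nonneg: "\<And>w u. 0 \<le> \<phi> (w, u)"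
    and int_u: "\<And>w. w \<in> space M \<Longrightarrow> integrable P (\<lambda>u. \<phi> (w, u))"
    and bound: "\<And>w. w \<in> space M \<Longrightarrow> (LINT u|P. \<phi> (w, u)) \<le> V w"
    and V: "integrable M V" and A: "A \<in> sets N"
  shows "expect_on M A (\<lambda>w. \<phi> (w, Z w)) \<le> expect_on M A V"
proof -
  note [measurable] = \<phi> A
  have V0: "0 \<le> V w" if "w \<in> space M" for w
    using bound[OF that] Bochner_Integration.integral_nonneg[of P "\<lambda>u. \<phi> (w, u)"] nonneg
    by (meson order_trans)
  have int: "integrable M (\<lambda>w. indicator A w * \<phi> (w, Z w))"
    using integrable_integrate_out[OF \<phi> nonneg int_u bound V] sets_N[OF A]
    by (rule integrable_indicator_times)
  have "(LINT w|M. indicator A w * \<phi> (w, Z w)) = (LINT w|M. LINT u|P. indicator A w * \<phi> (w, u))"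
    using integral_integrate_out[of "\<lambda>(w, u). indicator A w * \<phi> (w, u)"] int by simp
  also have "\<dots> = (LINT w|M. indicator A w * (LINT u|P. \<phi> (w, u)))"
    by simp
  also have "\<dots> \<le> (LINT w|M. indicator A w * V w)"
    using V A bound V0 integrable_indicator_times[OF V sets_N[OF A]]
    by (intro integral_mono') (auto simp: indicator_def)
  finally show ?thesis .
qed

text \<open>The only way in which unbiasedness enters: a fresh centred vector is orthogonal to the
  history, so all cross terms below vanish.\<close>
lemma integral_inner_centred:
  fixes Y :: "'w \<Rightarrow> 'a::euclidean_space" and v :: "'w \<times> 'u \<Rightarrow> 'a"
  assumes Y: "Y \<in> borel_measurable N" "square_integrable M Y"
    and v: "v \<in> borel_measurable (N \<Otimes>\<^sub>M P)" "square_integrable M (\<lambda>w. v (w, Z w))"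
    and int_u: "\<And>w. w \<in> space M \<Longrightarrow> integrable P (\<lambda>u. v (w, u))"
    and centred: "\<And>w. w \<in> space M \<Longrightarrow> (LINT u|P. v (w, u)) = 0"
  shows "(LINT w|M. Y w \<bullet> v (w, Z w)) = 0"
proof -
  note [measurable] = Y(1) v(1)
  have "(LINT w|M. Y w \<bullet> v (w, Z w)) = (LINT w|M. LINT u|P. Y w \<bullet> v (w, u))"
    using integral_integrate_out[of "\<lambda>(w, u). Y w \<bullet> v (w, u)"] square_integrable_inner[OF Y(2) v(2)]
    by simp
  also have "\<dots> = (LINT w|M. 0)"
    using int_u centred by (intro Bochner_Integration.integral_cong) auto
  finally show ?thesis by simp
qed

lemma quantization_measurable:
  assumes "quantization \<omega> P q" "y \<in> borel_measurable B" "Y \<in> measurable B P"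
  shows "(\<lambda>w. q (y w) (Y w)) \<in> borel_measurable B"
  using assms measurable_compose[OF measurable_Pair[OF assms(2,3)], of "\<lambda>(x, u). q x u" borel]
  by (simp add: quantization_def)

context
  fixes \<omega> :: real and q :: "'a::euclidean_space \<Rightarrow> 'u \<Rightarrow> 'a" and y :: "'w \<Rightarrow> 'a"
  assumes q: "quantization \<omega> P q" and y: "y \<in> borel_measurable N" "square_integrable M y"
begin

lemma quantization_error_measurable: "(\<lambda>(w, u). q (y w) u - y w) \<in> borel_measurable (N \<Otimes>\<^sub>M P)"
  using quantization_measurable[OF q measurable_compose[OF measurable_fst y(1)] measurable_snd] y(1)
  by (simp add: case_prod_beta)

lemma square_integrable_quantization_error: "square_integrable M (\<lambda>w. q (y w) (Z w) - y w)"
  and quantization_error_bound: "A \<in> sets N \<Longrightarrow>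
    expect_on M A (\<lambda>w. (norm (q (y w) (Z w) - y w))\<^sup>2) \<le> \<omega> * expect_on M A (\<lambda>w. (norm (y w))\<^sup>2)"
proof -
  let ?\<phi> = "\<lambda>(w, u). (norm (q (y w) u - y w))\<^sup>2"
  have \<phi>: "?\<phi> \<in> borel_measurable (N \<Otimes>\<^sub>M P)"
    using quantization_error_measurable by (simp add: case_prod_beta)
  have V: "integrable M (\<lambda>w. \<omega> * (norm (y w))\<^sup>2)"
    using y(2) by (simp add: square_integrable_def)
  have "(\<lambda>w. q (y w) (Z w)) \<in> borel_measurable M"
    by (rule quantization_measurable[OF q measurable_from_subalg[OF subalg y(1)] Z_measurable])
  then show "square_integrable M (\<lambda>w. q (y w) (Z w) - y w)"
    using integrable_integrate_out[OF \<phi>, of "\<lambda>w. \<omega> * (norm (y w))\<^sup>2"] q V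
      square_integrable_measurable[OF y(2)]
    by (simp add: quantization_def square_integrable_def)
  show "expect_on M A (\<lambda>w. (norm (q (y w) (Z w) - y w))\<^sup>2) \<le> \<omega> * expect_on M A (\<lambda>w. (norm (y w))\<^sup>2)"
    if "A \<in> sets N"
    using expect_on_bound[OF \<phi>, of "\<lambda>w. \<omega> * (norm (y w))\<^sup>2" A] q V that
    unfolding expect_on_cmult by (simp add: quantization_def)
qed

lemma quantization_error_orthogonal:
  assumes "Y \<in> borel_measurable N" "square_integrable M Y"
  shows "(LINT w|M. Y w \<bullet> (q (y w) (Z w) - y w)) = 0"
  using integral_inner_centred[OF assms quantization_error_measurable]
    square_integrable_quantization_error q
  by (simp add: quantization_def P.prob_space)

end

end

section \<open>Unrolling the recursion\<close>

lemma weight_pos: "\<eta> < 1 \<Longrightarrow> 0 < weight \<eta> k"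
  by (simp add: weight_def)

lemma weight_sum_ge: "\<eta> < 1 \<Longrightarrow> weight \<eta> K \<le> weight_sum \<eta> K"
  unfolding weight_sum_def using weight_pos[of \<eta>]
  by (intro member_le_sum) (auto intro: less_imp_le)

lemma weight_sum_pos: "\<eta> < 1 \<Longrightarrow> 0 < weight_sum \<eta> K"
  using weight_sum_ge weight_pos less_le_trans by blast

text \<open>Multiplied by the weight of index \<open>k\<close>, the contraction factor \<open>1 - \<eta>\<close> in front of \<open>T k\<close> becomes the
  weight of index \<open>k - 1\<close>, so the sum telescopes.\<close>
lemma weighted_sum_of_contraction:
  fixes T d :: "nat \<Rightarrow> real"
  assumes step: "\<And>k. T (Suc k) + c * d k \<le> (1 - \<eta>) * T k + b" and "\<eta> < 1" and T: "\<And>k. 0 \<le> T k"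
  shows "c * (\<Sum>k\<le>K. weight \<eta> k * d k) \<le> T 0 + b * weight_sum \<eta> K"
proof -
  have w: "weight \<eta> k * (1 - \<eta>) = 1 / (1 - \<eta>) ^ k" for k
    using \<open>\<eta> < 1\<close> by (simp add: weight_def)
  have step': "weight \<eta> k * T (Suc k) + c * (weight \<eta> k * d k) \<le> 1 / (1 - \<eta>) ^ k * T k + b * weight \<eta> k" for k
  proof -
    have "weight \<eta> k * (T (Suc k) + c * d k) \<le> weight \<eta> k * ((1 - \<eta>) * T k + b)"
      using step[of k] weight_pos[OF \<open>\<eta> < 1\<close>] by (intro mult_left_mono) (auto intro: less_imp_le)
    also have "\<dots> = (weight \<eta> k * (1 - \<eta>)) * T k + b * weight \<eta> k"
      by (simp add: algebra_simps)
    finally show ?thesis unfolding w by (simp add: algebra_simps)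
  qed
  have "weight \<eta> K * T (Suc K) + c * (\<Sum>k\<le>K. weight \<eta> k * d k) \<le> T 0 + b * weight_sum \<eta> K"
  proof (induction K)
    case 0
    then show ?case using step'[of 0] by (simp add: weight_sum_def)
  next
    case (Suc K)
    have "1 / (1 - \<eta>) ^ Suc K = weight \<eta> K" by (simp add: weight_def)
    with Suc step'[of "Suc K"]
    have "weight \<eta> (Suc K) * T (Suc (Suc K)) +
        (c * (\<Sum>k\<le>K. weight \<eta> k * d k) + c * (weight \<eta> (Suc K) * d (Suc K)))
        \<le> T 0 + (b * weight_sum \<eta> K + b * weight \<eta> (Suc K))"
      by (simp del: power_Suc)
    then show ?case by (simp add: weight_sum_def distrib_left)
  qed
  moreover have "0 \<le> weight \<eta> K * T (Suc K)"
    using T weight_pos[OF \<open>\<eta> < 1\<close>] by (intro mult_nonneg_nonneg) (auto intro: less_imp_le)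
  ultimately show ?thesis by linarith
qed

section \<open>The algorithm\<close>

locale dianasr_dq =
  fixes F :: "'n::finite \<Rightarrow> 'm::finite \<Rightarrow> 'a::euclidean_space \<Rightarrow> real"
    and D :: "'n \<Rightarrow> (real^'m) measure"
    and P1 :: "'u measure" and P2 :: "'v measure"
    and q1 :: "'a \<Rightarrow> 'u \<Rightarrow> 'a" and q2 :: "'a \<Rightarrow> 'v \<Rightarrow> 'a"
    and M :: "'w measure"
    and \<xi> :: "nat \<Rightarrow> 'n \<Rightarrow> 'w \<Rightarrow> real^'m"
    and U1 :: "nat \<Rightarrow> 'n \<Rightarrow> 'w \<Rightarrow> 'u" and U2 :: "nat \<Rightarrow> 'w \<Rightarrow> 'v"
    and x g2 g :: "nat \<Rightarrow> 'w \<Rightarrow> 'a" and h \<Delta> :: "nat \<Rightarrow> 'n \<Rightarrow> 'w \<Rightarrow> 'a"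
    and x0 xs :: 'a and h0 :: "'n \<Rightarrow> 'a"
    and L \<L> \<mu> \<gamma> \<alpha> \<omega>1 \<omega>2 n :: real
  assumes n_def: "n = real CARD('n)"
    and component_differentiable: "\<And>i j y. F i j differentiable (at y)"
    and local_convex: "\<And>i. convex_on UNIV (local_loss F i)"
    and local_smooth: "\<And>i. smooth_fun L (local_loss F i)"
    and qsc: "quasi_strongly_convex \<mu> (global_loss F) xs"
    and sampling: "\<And>i. sampling_distribution (D i)"
    and exp_smooth: "expected_smoothness F D \<L> xs"
    and finite_noise: "\<And>i. integrable (D i) (noise_sq F xs i)"
    and omega_pos: "\<omega>1 > 0" "\<omega>2 > 0"
    and quant1: "quantization \<omega>1 P1 q1"
    and quant2: "quantization \<omega>2 P2 q2"
    and randomness: "fresh_randomness M D \<xi> P1 U1 P2 U2"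
    and run: "dianasr_dq_run F \<gamma> \<alpha> x0 h0 q1 q2 M \<xi> U1 U2 x h \<Delta> g2 g"
begin

abbreviation (input) "f \<equiv> global_loss F"
abbreviation (input) "gap y \<equiv> global_loss F y - global_loss F xs"
abbreviation (input) "breg i y \<equiv> bregman (local_loss F i) y xs"
abbreviation (input) "opt i \<equiv> grad (local_loss F i) xs"
abbreviation (input) "noise i \<equiv> (LINT z|D i. noise_sq F xs i z)"

subsection \<open>Deterministic facts about the losses\<close>

lemma n_pos: "0 < n" by (simp add: n_def card_gt_0_iff)

lemma grad_sampled_loss:
  "grad (sampled_loss F i z) y = (1 / real CARD('m)) *\<^sub>R (\<Sum>j\<in>UNIV. (z $ j) *\<^sub>R grad (F i j) y)"
  unfolding sampled_loss_def[abs_def] by (intro grad_weighted_sum component_differentiable)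

lemma grad_local_loss:
  "grad (local_loss F i) y = (1 / real CARD('m)) *\<^sub>R (\<Sum>j\<in>UNIV. grad (F i j) y)"
  using grad_weighted_sum[of UNIV "F i" y "1 / real CARD('m)" "\<lambda>_. 1"] component_differentiable
  unfolding local_loss_def[abs_def] by simp

lemma local_differentiable: "local_loss F i differentiable (at y)"
  using local_smooth[of i] by (simp add: smooth_fun_def)

lemma global_differentiable: "f differentiable (at y)"
proof -
  have "(\<lambda>x. \<Sum>i\<in>UNIV. local_loss F i x) differentiable (at y)"
    by (intro differentiable_sum) (auto simp: local_differentiable)
  then show ?thesis
    unfolding global_loss_def[abs_def] by (intro differentiable_mult differentiable_const)
qed

lemma grad_global_loss: "grad f y = (1 / n) *\<^sub>R (\<Sum>i\<in>UNIV. grad (local_loss F i) y)"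
  using grad_weighted_sum[of UNIV "local_loss F" y "1 / n" "\<lambda>_. 1"] local_differentiable
  unfolding global_loss_def[abs_def] n_def by simp

lemma gap_nonneg: "0 \<le> gap y"
  using qsc by (simp add: quasi_strongly_convex_def)

lemma grad_global_opt: "grad f xs = 0"
  using gap_nonneg by (intro grad_at_minimizer global_differentiable) simp

lemma sum_opt: "(\<Sum>i\<in>UNIV. opt i) = 0"
  using grad_global_opt n_pos by (simp add: grad_global_loss)

lemma breg_nonneg: "0 \<le> breg i y"
  by (intro bregman_nonneg local_convex local_differentiable)

text \<open>The linear terms of the local Bregman divergences cancel, because the local gradients at
  the minimizer sum to zero.\<close>
lemma sum_breg: "(\<Sum>i\<in>UNIV. breg i y) = n * gap y"
proof -
  have "(\<Sum>i\<in>UNIV. breg i y) = (\<Sum>i\<in>UNIV. local_loss F i y) - (\<Sum>i\<in>UNIV. local_loss F i xs)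
      - (\<Sum>i\<in>UNIV. opt i) \<bullet> (y - xs)"
    by (simp add: bregman_def sum_subtractf inner_sum_left)
  then show ?thesis
    using n_pos by (simp add: sum_opt global_loss_def right_diff_distrib n_def)
qed

lemma breg_le: "breg i y \<le> n * gap y"
  unfolding sum_breg[symmetric] using breg_nonneg by (intro member_le_sum) auto

lemma local_grad_lipschitz: "norm (grad (local_loss F i) y - grad (local_loss F i) z) \<le> L * norm (y - z)"
  using local_smooth[of i] by (auto simp: smooth_fun_def intro: lipschitz_on_normD)

lemma L_nonneg: "0 \<le> L"
  using local_smooth[of undefined] by (auto simp: smooth_fun_def intro: lipschitz_on_nonneg)

text \<open>Convexity at the current point, instead of a descent lemma, suffices for this quadratic bound; its
  only use is to make the gap integrable.\<close>
lemma gap_le: "gap y \<le> L * (norm (y - xs))\<^sup>2"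
proof -
  have "local_loss F i y - local_loss F i xs - opt i \<bullet> (y - xs) \<le> L * (norm (y - xs))\<^sup>2" for i
  proof -
    have "0 \<le> bregman (local_loss F i) xs y"
      by (intro bregman_nonneg local_convex local_differentiable)
    then have "local_loss F i y - local_loss F i xs - opt i \<bullet> (y - xs)
        \<le> (grad (local_loss F i) y - opt i) \<bullet> (y - xs)"
      by (simp add: bregman_def inner_diff)
    also have "\<dots> \<le> norm (grad (local_loss F i) y - opt i) * norm (y - xs)"
      by (rule norm_cauchy_schwarz)
    also have "\<dots> \<le> L * norm (y - xs) * norm (y - xs)"
      by (intro mult_right_mono local_grad_lipschitz) auto
    finally show ?thesis by (simp add: power2_eq_square)
  qed
  then have "(\<Sum>i\<in>UNIV. breg i y) \<le> (\<Sum>i::'n\<in>UNIV. L * (norm (y - xs))\<^sup>2)"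
    unfolding bregman_def by (intro sum_mono)
  then show ?thesis
    using n_pos by (simp add: sum_breg n_def)
qed

text \<open>Were \<open>\<L>\<close> negative, every Bregman divergence at \<open>xs\<close> would vanish and \<open>f\<close> would be
  constant, contradicting uniqueness of the minimizer.\<close>
lemma expected_smoothness_constant_nonneg: "0 \<le> \<L>"
proof (rule ccontr)
  assume neg: "\<not> 0 \<le> \<L>"
  have "breg i y = 0" for i y
  proof -
    have "0 \<le> (LINT z|D i. (norm (grad (sampled_loss F i z) y - grad (sampled_loss F i z) xs))\<^sup>2)"
      by simp
    also have "\<dots> \<le> 2 * \<L> * breg i y"
      using exp_smooth by (simp add: expected_smoothness_def)
    finally show ?thesis
      using neg breg_nonneg[of i y] by (smt (verit) mult_neg_pos)
  qed
  then have const: "f y = f xs" for y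
    using sum_breg[of y] n_pos by simp
  obtain b :: 'a where "b \<in> Basis" using nonempty_Basis by blast
  then have "xs + b \<noteq> xs" using nonzero_Basis by auto
  moreover have "xs + b = xs"
    using qsc const unfolding quasi_strongly_convex_def by metis
  ultimately show False by blast
qed

lemma local_loss_measurable [measurable]: "local_loss F i \<in> borel_measurable borel"
  by (intro borel_measurable_continuous_onI)
    (simp add: continuous_on_eq_continuous_at differentiable_imp_continuous_within local_differentiable)

lemma global_loss_measurable [measurable]: "f \<in> borel_measurable borel"
  by (intro borel_measurable_continuous_onI)
    (simp add: continuous_on_eq_continuous_at differentiable_imp_continuous_within global_differentiable)

lemma grad_component_measurable [measurable]: "grad (F i j) \<in> borel_measurable borel"
  by (intro borel_measurable_grad component_differentiable)

lemma grad_local_measurable [measurable]: "grad (local_loss F i) \<in> borel_measurable borel"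
  by (intro borel_measurable_grad local_differentiable)

lemma breg_measurable [measurable]: "breg i \<in> borel_measurable borel"
  unfolding bregman_def by measurable

lemma noise_nonneg: "0 \<le> noise i"
  by (intro Bochner_Integration.integral_nonneg) (simp add: noise_sq_def)

lemma grad_global_measurable [measurable]: "grad f \<in> borel_measurable borel"
  by (intro borel_measurable_grad global_differentiable)

lemma convex_global: "convex_on UNIV f"
proof (rule convex_onI)
  fix t :: real and y z :: 'a
  assume t: "0 < t" "t < 1"
  have "(\<Sum>i\<in>UNIV. local_loss F i ((1 - t) *\<^sub>R y + t *\<^sub>R z))
      \<le> (\<Sum>i\<in>UNIV. (1 - t) * local_loss F i y + t * local_loss F i z)"
    using t by (intro sum_mono convex_onD[OF local_convex]) auto
  then have "f ((1 - t) *\<^sub>R y + t *\<^sub>R z)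
      \<le> (1 / n) * (\<Sum>i\<in>UNIV. (1 - t) * local_loss F i y + t * local_loss F i z)"
    unfolding global_loss_def n_def by (intro mult_left_mono) auto
  also have "\<dots> = (1 - t) * f y + t * f z"
    unfolding n_def global_loss_def sum.distrib sum_distrib_left[symmetric]
    by (simp add: algebra_simps add_divide_distrib diff_divide_distrib)
  finally show "f ((1 - t) *\<^sub>R y + t *\<^sub>R z) \<le> (1 - t) * f y + t * f z" .
qed simp

subsection \<open>The information generated by a set of sources\<close>

abbreviation (input) "events_of s \<equiv> source_events M \<xi> P1 U1 P2 U2 s"

text \<open>Within one iteration the randomness is revealed source by source. Indexing the \<open>\<sigma>\<close>-algebras by
  arbitrary sets of sources gives all intermediate stages at once, not only the pasts of the
  iterations.\<close>
definition info :: "'n source set \<Rightarrow> 'w measure" where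
  "info S = sigma (space M) (\<Union>s\<in>S. events_of s)"

abbreviation (input) "before k \<equiv> {s :: 'n source. iteration s < k}"

lemma past_eq_info: "past M \<xi> P1 U1 P2 U2 k = info (before k)"
  by (simp add: past_def info_def)

sublocale prob_space M
  using randomness by (simp add: fresh_randomness_def)

lemma xi_measurable [measurable]: "\<xi> k i \<in> borel_measurable M"
  and U1_measurable [measurable]: "U1 k i \<in> measurable M P1"
  and U2_measurable [measurable]: "U2 k \<in> measurable M P2"
  using randomness by (auto simp: fresh_randomness_def)

lemma events_of_sub: "events_of s \<subseteq> sets M"
  by (cases s) auto

lemma events_of_Pow: "(\<Union>s\<in>S. events_of s) \<subseteq> Pow (space M)"
  using events_of_sub sets.sets_into_space by blast

lemma space_info: "space (info S) = space M"
  unfolding info_def by (rule space_measure_of[OF events_of_Pow])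

lemma sets_info: "sets (info S) = sigma_sets (space M) (\<Union>s\<in>S. events_of s)"
  unfolding info_def by (rule sets_measure_of[OF events_of_Pow])

lemma info_subalgebra: "subalgebra M (info S)"
  using events_of_sub sets.sigma_sets_subset[of "\<Union>s\<in>S. events_of s" M]
  by (auto simp: subalgebra_def space_info sets_info)

lemma info_mono: "S \<subseteq> T \<Longrightarrow> subalgebra (info T) (info S)"
  unfolding subalgebra_def space_info sets_info by (auto intro!: sigma_sets_mono')

lemma measurable_info_mono:
  assumes "X \<in> measurable (info S) B" "S \<subseteq> T" shows "X \<in> measurable (info T) B"
  using measurable_from_subalg[OF info_mono] assms by blast

lemma measurable_info:
  assumes "X \<in> measurable (info S) B" shows "X \<in> measurable M B"
  using measurable_from_subalg[OF info_subalgebra] assms by blast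

lemma events_of_info: "s \<in> S \<Longrightarrow> E \<in> events_of s \<Longrightarrow> E \<in> sets (info S)"
  unfolding sets_info by (intro sigma_sets.Basic) auto

lemma xi_info:
  assumes "Sample k i \<in> S" shows "\<xi> k i \<in> borel_measurable (info S)"
proof (rule measurableI)
  fix A :: "(real^'m) set" assume "A \<in> sets borel"
  then show "\<xi> k i -` A \<inter> space (info S) \<in> sets (info S)"
    by (intro events_of_info[OF assms]) (auto simp: space_info)
qed simp

lemma U1_info:
  assumes "Worker_Seed k i \<in> S" shows "U1 k i \<in> measurable (info S) P1"
proof (rule measurableI)
  fix A assume "A \<in> sets P1"
  then show "U1 k i -` A \<inter> space (info S) \<in> sets (info S)"
    by (intro events_of_info[OF assms]) (auto simp: space_info)
qed (use measurable_space[OF U1_measurable] in \<open>simp add: space_info\<close>)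

lemma U2_info:
  assumes "Master_Seed k \<in> S" shows "U2 k \<in> measurable (info S) P2"
proof (rule measurableI)
  fix A assume "A \<in> sets P2"
  then show "U2 k -` A \<inter> space (info S) \<in> sets (info S)"
    by (intro events_of_info[OF assms]) (auto simp: space_info)
qed (use measurable_space[OF U2_measurable] in \<open>simp add: space_info\<close>)

lemma Int_stable_preimages: "Int_stable {X -` A \<inter> \<Omega> | A. A \<in> sets B}"
proof (rule Int_stableI)
  fix a b assume "a \<in> {X -` A \<inter> \<Omega> | A. A \<in> sets B}" "b \<in> {X -` A \<inter> \<Omega> | A. A \<in> sets B}"
  then obtain A A' where "A \<in> sets B" "A' \<in> sets B" "a = X -` A \<inter> \<Omega>" "b = X -` A' \<inter> \<Omega>" by auto
  then show "a \<inter> b \<in> {X -` A \<inter> \<Omega> | A. A \<in> sets B}"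
    by (intro CollectI exI[of _ "A \<inter> A'"]) auto
qed

lemma source_independent:
  assumes "s \<notin> S" and A: "A \<in> sets (info S)" and E: "E \<in> events_of s"
  shows "prob (A \<inter> E) = prob A * prob E"
proof -
  have "indep_sets (\<lambda>b. sigma_sets (space M) (\<Union>s\<in>case_bool S {s} b. events_of s)) UNIV"
  proof (rule indep_sets_collect_sigma)
    have "indep_sets events_of UNIV"
      using randomness by (simp add: fresh_randomness_def)
    then show "indep_sets events_of (\<Union>b\<in>UNIV. case_bool S {s} b)"
      by (rule indep_sets_mono_index[rotated]) simp
    show "Int_stable (events_of s)" for s
      by (cases s) (auto intro: Int_stable_preimages)
    show "disjoint_family_on (case_bool S {s}) UNIV"
      using \<open>s \<notin> S\<close> by (auto simp: disjoint_family_on_def split: bool.split)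
  qed
  from indep_setsD[OF this, of UNIV "case_bool A E"]
  show ?thesis
    using A E by (auto simp: UNIV_bool sets_info Int_commute mult.commute intro: sigma_sets.Basic)
qed

lemma fresh_sample: "Sample k i \<notin> S \<Longrightarrow> fresh_seed M (info S) (D i) (\<xi> k i)"
proof -
  assume *: "Sample k i \<notin> S"
  have D: "prob_space (D i)" "sets (D i) = sets borel"
    using sampling[of i] by (auto simp: sampling_distribution_def)
  have "distr M (D i) (\<xi> k i) = distr M borel (\<xi> k i)"
    using D by (intro distr_cong) auto
  then have "distr M (D i) (\<xi> k i) = D i"
    using randomness by (simp add: fresh_randomness_def)
  moreover have "\<xi> k i \<in> measurable M (D i)"
    using xi_measurable measurable_cong_sets[OF refl D(2)] by blast
  moreover have "prob (A \<inter> (\<xi> k i -` B \<inter> space M)) = prob A * prob (\<xi> k i -` B \<inter> space M)"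
    if "A \<in> sets (info S)" "B \<in> sets (D i)" for A B
    using that D by (intro source_independent[OF *]) auto
  ultimately show ?thesis
    by (intro fresh_seed.intro fresh_seed_axioms.intro prob_space_axioms D(1) info_subalgebra)
qed

lemma fresh_worker_seed: "Worker_Seed k i \<notin> S \<Longrightarrow> fresh_seed M (info S) P1 (U1 k i)"
proof -
  assume *: "Worker_Seed k i \<notin> S"
  show ?thesis
  proof (intro fresh_seed.intro fresh_seed_axioms.intro prob_space_axioms info_subalgebra)
    show "prob_space P1" using quant1 by (simp add: quantization_def)
    show "U1 k i \<in> measurable M P1" "distr M P1 (U1 k i) = P1"
      using randomness by (simp_all add: fresh_randomness_def)
    show "prob (A \<inter> (U1 k i -` B \<inter> space M)) = prob A * prob (U1 k i -` B \<inter> space M)"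
      if "A \<in> sets (info S)" "B \<in> sets P1" for A B
      using that by (intro source_independent[OF *]) auto
  qed
qed

lemma fresh_master_seed: "Master_Seed k \<notin> S \<Longrightarrow> fresh_seed M (info S) P2 (U2 k)"
proof -
  assume *: "Master_Seed k \<notin> S"
  show ?thesis
  proof (intro fresh_seed.intro fresh_seed_axioms.intro prob_space_axioms info_subalgebra)
    show "prob_space P2" using quant2 by (simp add: quantization_def)
    show "U2 k \<in> measurable M P2" "distr M P2 (U2 k) = P2"
      using randomness by (simp_all add: fresh_randomness_def)
    show "prob (A \<inter> (U2 k -` B \<inter> space M)) = prob A * prob (U2 k -` B \<inter> space M)"
      if "A \<in> sets (info S)" "B \<in> sets P2" for A B
      using that by (intro source_independent[OF *]) auto
  qed
qed

subsection \<open>Measurability and errors within one iteration\<close>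

lemma run_init: "w \<in> space M \<Longrightarrow> x 0 w = x0" "w \<in> space M \<Longrightarrow> h 0 i w = h0 i"
  and run_step:
    "w \<in> space M \<Longrightarrow> \<Delta> k i w = q1 (grad (sampled_loss F i (\<xi> k i w)) (x k w) - h k i w) (U1 k i w)"
    "w \<in> space M \<Longrightarrow> h (Suc k) i w = h k i w + \<alpha> *\<^sub>R \<Delta> k i w"
    "w \<in> space M \<Longrightarrow> g2 k w = (1 / n) *\<^sub>R (\<Sum>i\<in>UNIV. h k i w + \<Delta> k i w)"
    "w \<in> space M \<Longrightarrow> g k w = q2 (g2 k w) (U2 k w)"
    "w \<in> space M \<Longrightarrow> x (Suc k) w = x k w - \<gamma> *\<^sub>R g k w"
  using run unfolding dianasr_dq_run_def n_def by blast+

lemma measurable_info_cong: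
  assumes "\<And>w. w \<in> space M \<Longrightarrow> X w = Y w" "Y \<in> borel_measurable (info T)"
  shows "X \<in> borel_measurable (info T)"
  using assms measurable_cong[of "info T" X Y] by (simp add: space_info)

text \<open>The noise of an iteration is split by origin: sampling (\<open>stoch_grad\<close> around the local
  gradient), worker quantizers, master quantizer.\<close>
definition stoch_grad :: "nat \<Rightarrow> 'n \<Rightarrow> 'w \<Rightarrow> 'a" where
  "stoch_grad k i w = grad (sampled_loss F i (\<xi> k i w)) (x k w)"

definition stoch_grad_opt :: "nat \<Rightarrow> 'n \<Rightarrow> 'w \<Rightarrow> 'a" where
  "stoch_grad_opt k i w = grad (sampled_loss F i (\<xi> k i w)) xs"

definition worker_error :: "nat \<Rightarrow> 'n \<Rightarrow> 'w \<Rightarrow> 'a" where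
  "worker_error k i w = \<Delta> k i w - (stoch_grad k i w - h k i w)"

definition master_error :: "nat \<Rightarrow> 'w \<Rightarrow> 'a" where
  "master_error k w = g k w - g2 k w"

lemma sampled_grad_measurable:
  assumes [measurable]: "y \<in> borel_measurable B" "Z \<in> borel_measurable B"
  shows "(\<lambda>w. grad (sampled_loss F i (Z w)) (y w)) \<in> borel_measurable B"
proof -
  have "(\<lambda>z::real^'m. z $ j) \<in> borel_measurable borel" for j
    by (intro borel_measurable_continuous_onI continuous_intros)
  from measurable_compose[OF assms(2) this] have [measurable]: "(\<lambda>w. Z w $ j) \<in> borel_measurable B" for j .
  show ?thesis
    unfolding grad_sampled_loss by measurable
qed

lemma sampled_grad_mean:
  "integrable (D i) (\<lambda>z. grad (sampled_loss F i z) y)"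
  "(LINT z|D i. grad (sampled_loss F i z) y) = grad (local_loss F i) y"
  using sampling[of i] unfolding sampling_distribution_def grad_sampled_loss grad_local_loss
  by (auto simp: integral_scaleR_left)

lemma stoch_grad_info:
  assumes "x k \<in> borel_measurable (info T)" "Sample k i \<in> T"
  shows "stoch_grad k i \<in> borel_measurable (info T)"
  unfolding stoch_grad_def[abs_def] by (intro sampled_grad_measurable assms(1) xi_info assms(2))

lemma Delta_info:
  assumes "x k \<in> borel_measurable (info T)" "h k i \<in> borel_measurable (info T)"
    and "Sample k i \<in> T" "Worker_Seed k i \<in> T"
  shows "\<Delta> k i \<in> borel_measurable (info T)"
proof (rule measurable_info_cong)
  interpret fresh_seed M "info {}" P1 "U1 k i" by (rule fresh_worker_seed) simp
  show "(\<lambda>w. q1 (stoch_grad k i w - h k i w) (U1 k i w)) \<in> borel_measurable (info T)"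
    by (intro quantization_measurable[OF quant1] borel_measurable_diff stoch_grad_info assms U1_info)
qed (simp add: run_step stoch_grad_def)

lemma g2_info:
  assumes "x k \<in> borel_measurable (info T)" "\<And>i. h k i \<in> borel_measurable (info T)"
    and "\<And>i. Sample k i \<in> T" "\<And>i. Worker_Seed k i \<in> T"
  shows "g2 k \<in> borel_measurable (info T)"
proof (rule measurable_info_cong)
  note [measurable] = assms(2) Delta_info[OF assms]
  show "(\<lambda>w. (1 / n) *\<^sub>R (\<Sum>i\<in>UNIV. h k i w + \<Delta> k i w)) \<in> borel_measurable (info T)"
    by measurable
qed (simp add: run_step)

text \<open>Iterates and shifts of iteration \<open>k\<close> depend on earlier sources only, so every source of
  iteration \<open>k\<close> is fresh for them.\<close>
lemma state_before: "x k \<in> borel_measurable (info (before k)) \<and> (\<forall>i. h k i \<in> borel_measurable (info (before k)))"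
proof (induction k)
  case 0
  have "x 0 \<in> borel_measurable (info (before 0))"
    by (rule measurable_info_cong[of _ "\<lambda>_. x0"]) (auto simp: run_init)
  moreover have "h 0 i \<in> borel_measurable (info (before 0))" for i
    by (rule measurable_info_cong[of _ "\<lambda>_. h0 i"]) (auto simp: run_init)
  ultimately show ?case by blast
next
  case (Suc k)
  let ?T = "before (Suc k)"
  have x [measurable]: "x k \<in> borel_measurable (info ?T)" and h [measurable]: "h k i \<in> borel_measurable (info ?T)" for i
    using Suc by (auto intro: measurable_info_mono[of _ "before k"])
  have [measurable]: "\<Delta> k i \<in> borel_measurable (info ?T)" for i
    by (intro Delta_info x h) auto
  have g2: "g2 k \<in> borel_measurable (info ?T)"
    by (intro g2_info x h) auto
  interpret fresh_seed M "info {}" P2 "U2 k" by (rule fresh_master_seed) simp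
  have [measurable]: "g k \<in> borel_measurable (info ?T)"
  proof (rule measurable_info_cong)
    show "(\<lambda>w. q2 (g2 k w) (U2 k w)) \<in> borel_measurable (info ?T)"
      by (intro quantization_measurable[OF quant2] g2 U2_info) simp
  qed (simp add: run_step)
  have "x (Suc k) \<in> borel_measurable (info ?T)"
    by (rule measurable_info_cong[of _ "\<lambda>w. x k w - \<gamma> *\<^sub>R g k w"]) (auto simp: run_step(5))
  moreover have "h (Suc k) i \<in> borel_measurable (info ?T)" for i
    by (rule measurable_info_cong[of _ "\<lambda>w. h k i w + \<alpha> *\<^sub>R \<Delta> k i w"]) (auto simp: run_step(2))
  ultimately show ?case by blast
qed

lemma x_info: "before k \<subseteq> T \<Longrightarrow> x k \<in> borel_measurable (info T)"
  and h_info: "before k \<subseteq> T \<Longrightarrow> h k i \<in> borel_measurable (info T)"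
  using state_before measurable_info_mono by blast+

lemma x_measurable [measurable]: "x k \<in> borel_measurable M"
  using x_info[OF order_refl] measurable_info by blast

lemma sets_info_mono: "A \<in> sets (info S) \<Longrightarrow> S \<subseteq> T \<Longrightarrow> A \<in> sets (info T)"
  using info_mono[of S T] by (auto simp: subalgebra_def)

lemma sets_info_M: "A \<in> sets (info S) \<Longrightarrow> A \<in> sets M"
  using info_subalgebra by (auto simp: subalgebra_def)

context
  fixes k :: nat
  assumes x_si: "square_integrable M (x k)" and h_si: "\<And>i. square_integrable M (h k i)"
begin

lemma gap_integrable: "integrable M (\<lambda>w. gap (x k w))"
proof (rule Bochner_Integration.integrable_bound)
  show "integrable M (\<lambda>w. L * (norm (x k w - xs))\<^sup>2)"
    using square_integrable_norm[OF square_integrable_diff[OF x_si square_integrable_const]] by simp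
  show "AE w in M. norm (gap (x k w)) \<le> norm (L * (norm (x k w - xs))\<^sup>2)"
    using gap_nonneg gap_le L_nonneg by (intro AE_I2) simp
qed measurable

lemma breg_integrable: "integrable M (\<lambda>w. breg i (x k w))"
proof (rule Bochner_Integration.integrable_bound)
  show "integrable M (\<lambda>w. n * gap (x k w))"
    using gap_integrable by simp
  show "AE w in M. norm (breg i (x k w)) \<le> norm (n * gap (x k w))"
    using breg_nonneg breg_le gap_nonneg n_pos by (intro AE_I2) simp
qed measurable

lemma local_grad_si: "square_integrable M (\<lambda>w. grad (local_loss F i) (x k w))"
proof -
  have "square_integrable M (\<lambda>w. grad (local_loss F i) (x k w) - opt i)"
  proof (rule square_integrable_bound)
    show "integrable M (\<lambda>w. L\<^sup>2 * (norm (x k w - xs))\<^sup>2)"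
      using square_integrable_norm[OF square_integrable_diff[OF x_si square_integrable_const]] by simp
    show "(norm (grad (local_loss F i) (x k w) - opt i))\<^sup>2 \<le> L\<^sup>2 * (norm (x k w - xs))\<^sup>2" for w
      using power_mono[OF local_grad_lipschitz norm_ge_zero, of i "x k w" xs 2]
      by (simp add: power_mult_distrib)
  qed measurable
  from square_integrable_add[OF this square_integrable_const[of "opt i"]] show ?thesis by simp
qed

lemma x_pair: "(\<lambda>p. x k (fst p)) \<in> borel_measurable (info (before k) \<Otimes>\<^sub>M D i)"
  by (rule measurable_compose[OF measurable_fst x_info[OF order_refl]])

lemma seed_pair: "snd \<in> borel_measurable (B \<Otimes>\<^sub>M D i)"
proof -
  have "sets (D i) = sets borel"
    using sampling[of i] by (simp add: sampling_distribution_def)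
  from measurable_cong_sets[OF refl this] show ?thesis
    using measurable_snd[of B "D i"] by blast
qed

lemma stoch_diff_si: "square_integrable M (\<lambda>w. stoch_grad k i w - stoch_grad_opt k i w)"
  and stoch_diff_bound: "A \<in> sets (info (before k)) \<Longrightarrow>
    expect_on M A (\<lambda>w. (norm (stoch_grad k i w - stoch_grad_opt k i w))\<^sup>2)
      \<le> 2 * \<L> * expect_on M A (\<lambda>w. breg i (x k w))"
proof -
  interpret fresh_seed M "info (before k)" "D i" "\<xi> k i" by (rule fresh_sample) simp
  let ?\<phi> = "\<lambda>p. (norm (grad (sampled_loss F i (snd p)) (x k (fst p)) - grad (sampled_loss F i (snd p)) xs))\<^sup>2"
  have \<phi>: "?\<phi> \<in> borel_measurable (info (before k) \<Otimes>\<^sub>M D i)"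
    by (intro borel_measurable_power measurable_compose[OF _ borel_measurable_norm]
        borel_measurable_diff sampled_grad_measurable x_pair seed_pair) simp
  have V: "integrable M (\<lambda>w. 2 * \<L> * breg i (x k w))"
    using breg_integrable by simp
  have m: "(\<lambda>w. stoch_grad k i w - stoch_grad_opt k i w) \<in> borel_measurable M"
    unfolding stoch_grad_def stoch_grad_opt_def
    by (intro borel_measurable_diff sampled_grad_measurable) auto
  note E = exp_smooth[unfolded expected_smoothness_def, rule_format, of i]
  show "square_integrable M (\<lambda>w. stoch_grad k i w - stoch_grad_opt k i w)"
    using integrable_integrate_out[OF \<phi>, of "\<lambda>w. 2 * \<L> * breg i (x k w)"] E V m
    by (simp add: square_integrable_def stoch_grad_def stoch_grad_opt_def)
  show "expect_on M A (\<lambda>w. (norm (stoch_grad k i w - stoch_grad_opt k i w))\<^sup>2)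
      \<le> 2 * \<L> * expect_on M A (\<lambda>w. breg i (x k w))" if "A \<in> sets (info (before k))"
    using expect_on_bound[OF \<phi>, of "\<lambda>w. 2 * \<L> * breg i (x k w)" A] E V that
    unfolding expect_on_cmult by (simp add: stoch_grad_def stoch_grad_opt_def)
qed

lemma noise_si: "square_integrable M (\<lambda>w. stoch_grad_opt k i w - opt i)"
  and noise_bound: "A \<in> sets (info (before k)) \<Longrightarrow>
    expect_on M A (\<lambda>w. (norm (stoch_grad_opt k i w - opt i))\<^sup>2) \<le> noise i * prob A"
proof -
  interpret fresh_seed M "info (before k)" "D i" "\<xi> k i" by (rule fresh_sample) simp
  let ?\<phi> = "\<lambda>p. (norm (grad (sampled_loss F i (snd p)) xs - opt i))\<^sup>2"
  have \<phi>: "?\<phi> \<in> borel_measurable (info (before k) \<Otimes>\<^sub>M D i)"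
    by (intro borel_measurable_power measurable_compose[OF _ borel_measurable_norm]
        borel_measurable_diff sampled_grad_measurable seed_pair) simp_all
  have m: "(\<lambda>w. stoch_grad_opt k i w - opt i) \<in> borel_measurable M"
    unfolding stoch_grad_opt_def
    by (intro borel_measurable_diff sampled_grad_measurable) auto
  note E = finite_noise[of i, unfolded noise_sq_def[abs_def]]
  show "square_integrable M (\<lambda>w. stoch_grad_opt k i w - opt i)"
    using integrable_integrate_out[OF \<phi>, of "\<lambda>w. noise i"] E m
    by (simp add: square_integrable_def stoch_grad_opt_def noise_sq_def)
  show "expect_on M A (\<lambda>w. (norm (stoch_grad_opt k i w - opt i))\<^sup>2) \<le> noise i * prob A"
    if "A \<in> sets (info (before k))"
    using expect_on_bound[OF \<phi>, of "\<lambda>w. noise i" A] E that sets_info_M[OF that]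
    by (simp add: stoch_grad_opt_def noise_sq_def mult.commute)
qed

lemma stoch_grad_opt_si: "square_integrable M (stoch_grad_opt k i)"
  using square_integrable_add[OF noise_si[of i] square_integrable_const[of "opt i"]] by simp

lemma stoch_grad_si: "square_integrable M (stoch_grad k i)"
  using square_integrable_add[OF stoch_diff_si[of i] stoch_grad_opt_si[of i]] by simp

lemma stoch_grad_unbiased:
  assumes Y: "Y \<in> borel_measurable (info T)" "square_integrable M Y"
    and T: "before k \<subseteq> T" "Sample k i \<notin> T"
  shows "(LINT w|M. Y w \<bullet> (stoch_grad k i w - grad (local_loss F i) (x k w))) = 0"
proof -
  interpret fresh_seed M "info T" "D i" "\<xi> k i" using T(2) by (rule fresh_sample)
  have x': "(\<lambda>p. x k (fst p)) \<in> borel_measurable (info T \<Otimes>\<^sub>M D i)"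
    by (rule measurable_compose[OF measurable_fst x_info[OF T(1)]])
  let ?v = "\<lambda>p. grad (sampled_loss F i (snd p)) (x k (fst p)) - grad (local_loss F i) (x k (fst p))"
  have v: "?v \<in> borel_measurable (info T \<Otimes>\<^sub>M D i)"
    by (intro borel_measurable_diff sampled_grad_measurable x' seed_pair
        measurable_compose[OF x' grad_local_measurable])
  show ?thesis
    using integral_inner_centred[OF Y v] square_integrable_diff[OF stoch_grad_si local_grad_si]
      sampled_grad_mean
    by (simp add: stoch_grad_def P.prob_space)
qed

lemma stoch_grad_opt_unbiased:
  assumes Y: "Y \<in> borel_measurable (info T)" "square_integrable M Y" and T: "Sample k i \<notin> T"
  shows "(LINT w|M. Y w \<bullet> (stoch_grad_opt k i w - opt i)) = 0"
proof -
  interpret fresh_seed M "info T" "D i" "\<xi> k i" using T by (rule fresh_sample)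
  let ?v = "\<lambda>p. grad (sampled_loss F i (snd p)) xs - opt i"
  have v: "?v \<in> borel_measurable (info T \<Otimes>\<^sub>M D i)"
    by (intro borel_measurable_diff sampled_grad_measurable seed_pair) simp_all
  show ?thesis
    using integral_inner_centred[OF Y v] noise_si sampled_grad_mean
    by (simp add: stoch_grad_opt_def P.prob_space)
qed

lemma direction_si: "square_integrable M (\<lambda>w. stoch_grad k i w - h k i w)"
  by (intro square_integrable_diff stoch_grad_si h_si)

lemma direction_info:
  assumes "before k \<subseteq> T" "Sample k i \<in> T"
  shows "(\<lambda>w. stoch_grad k i w - h k i w) \<in> borel_measurable (info T)"
  using assms by (intro borel_measurable_diff stoch_grad_info x_info h_info)

lemma worker_error_eq: "w \<in> space M \<Longrightarrow>
    worker_error k i w = q1 (stoch_grad k i w - h k i w) (U1 k i w) - (stoch_grad k i w - h k i w)"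
  by (simp add: worker_error_def run_step stoch_grad_def)

lemma worker_error_si: "square_integrable M (worker_error k i)"
  and worker_error_bound: "A \<in> sets (info (before k)) \<Longrightarrow>
    expect_on M A (\<lambda>w. (norm (worker_error k i w))\<^sup>2)
      \<le> \<omega>1 * expect_on M A (\<lambda>w. (norm (stoch_grad k i w - h k i w))\<^sup>2)"
proof -
  let ?T = "insert (Sample k i) (before k)"
  interpret fresh_seed M "info ?T" P1 "U1 k i" by (rule fresh_worker_seed) simp
  have d: "(\<lambda>w. stoch_grad k i w - h k i w) \<in> borel_measurable (info ?T)"
    by (rule direction_info) auto
  show "square_integrable M (worker_error k i)"
    using square_integrable_quantization_error[OF quant1 d direction_si]
    by (simp add: worker_error_eq cong: square_integrable_cong)
  show "expect_on M A (\<lambda>w. (norm (worker_error k i w))\<^sup>2)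
      \<le> \<omega>1 * expect_on M A (\<lambda>w. (norm (stoch_grad k i w - h k i w))\<^sup>2)"
    if A: "A \<in> sets (info (before k))"
    using quantization_error_bound[OF quant1 d direction_si sets_info_mono[OF A]]
    by (simp add: worker_error_eq subset_insertI cong: expect_on_cong)
qed

text \<open>The set \<open>T\<close> is left open because several histories occur: with the sample of worker \<open>i\<close> only, with
  all samples of the iteration, and with the seed of one other worker in addition.\<close>
lemma worker_error_orthogonal:
  assumes Y: "Y \<in> borel_measurable (info T)" "square_integrable M Y"
    and T: "before k \<subseteq> T" "Sample k i \<in> T" "Worker_Seed k i \<notin> T"
  shows "(LINT w|M. Y w \<bullet> worker_error k i w) = 0"
proof -
  interpret fresh_seed M "info T" P1 "U1 k i" using T(3) by (rule fresh_worker_seed)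
  show ?thesis
    using quantization_error_orthogonal[OF quant1 direction_info[OF T(1,2)] direction_si Y]
    by (simp add: worker_error_eq cong: Bochner_Integration.integral_cong)
qed

lemma Delta_si: "square_integrable M (\<Delta> k i)"
  using square_integrable_add[OF worker_error_si[of i] direction_si[of i]] by (simp add: worker_error_def)

lemma g2_si: "square_integrable M (g2 k)"
proof -
  have "square_integrable M (\<lambda>w. (1 / n) *\<^sub>R (\<Sum>i\<in>UNIV. h k i w + \<Delta> k i w))"
    by (intro square_integrable_scaleR square_integrable_sum square_integrable_add h_si Delta_si)
  then show ?thesis
    by (simp add: run_step cong: square_integrable_cong)
qed

abbreviation (input) "until_master \<equiv> {s :: 'n source. iteration s \<le> k \<and> s \<noteq> Master_Seed k}"

lemma g2_until_master: "g2 k \<in> borel_measurable (info until_master)"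
  by (intro g2_info x_info h_info) auto

lemma master_error_eq: "w \<in> space M \<Longrightarrow> master_error k w = q2 (g2 k w) (U2 k w) - g2 k w"
  by (simp add: master_error_def run_step)

lemma master_error_si: "square_integrable M (master_error k)"
  and master_error_bound: "A \<in> sets (info (before k)) \<Longrightarrow>
    expect_on M A (\<lambda>w. (norm (master_error k w))\<^sup>2) \<le> \<omega>2 * expect_on M A (\<lambda>w. (norm (g2 k w))\<^sup>2)"
proof -
  interpret fresh_seed M "info until_master" P2 "U2 k" by (rule fresh_master_seed) simp
  show "square_integrable M (master_error k)"
    using square_integrable_quantization_error[OF quant2 g2_until_master g2_si]
    by (simp add: master_error_eq cong: square_integrable_cong)
  show "expect_on M A (\<lambda>w. (norm (master_error k w))\<^sup>2) \<le> \<omega>2 * expect_on M A (\<lambda>w. (norm (g2 k w))\<^sup>2)"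
    if A: "A \<in> sets (info (before k))"
  proof -
    have "A \<in> sets (info until_master)"
      by (rule sets_info_mono[OF A]) auto
    from quantization_error_bound[OF quant2 g2_until_master g2_si this] show ?thesis
      by (simp add: master_error_eq cong: expect_on_cong)
  qed
qed

lemma master_error_orthogonal:
  assumes Y: "Y \<in> borel_measurable (info until_master)" "square_integrable M Y"
  shows "(LINT w|M. Y w \<bullet> master_error k w) = 0"
proof -
  interpret fresh_seed M "info until_master" P2 "U2 k" by (rule fresh_master_seed) simp
  show ?thesis
    using quantization_error_orthogonal[OF quant2 g2_until_master g2_si Y]
    by (simp add: master_error_eq cong: Bochner_Integration.integral_cong)
qed

lemma g_si: "square_integrable M (g k)"
  using square_integrable_add[OF master_error_si g2_si] by (simp add: master_error_def)

end

text \<open>All integrability statements above assume that the state is square-integrable; this propagates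
  along the run.\<close>
lemma state_si: "square_integrable M (x k) \<and> (\<forall>i. square_integrable M (h k i))"
proof (induction k)
  case 0
  show ?case by (simp add: run_init square_integrable_const cong: square_integrable_cong)
next
  case (Suc k)
  then have si: "square_integrable M (x k)" "\<And>i. square_integrable M (h k i)" by auto
  have "square_integrable M (\<lambda>w. x k w - \<gamma> *\<^sub>R g k w)"
    by (intro square_integrable_diff square_integrable_scaleR g_si si)
  moreover have "square_integrable M (\<lambda>w. h k i w + \<alpha> *\<^sub>R \<Delta> k i w)" for i
    by (intro square_integrable_add square_integrable_scaleR Delta_si si)
  ultimately show ?case
    by (simp add: run_step(2,5) cong: square_integrable_cong)
qed

lemma x_si: "square_integrable M (x k)" and h_si: "square_integrable M (h k i)"
  using state_si by auto

subsection \<open>Moments of one iteration\<close>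

lemma indicator_info:
  fixes Y :: "'w \<Rightarrow> 'a"
  assumes "A \<in> sets (info S)" "S \<subseteq> T" "Y \<in> borel_measurable (info T)"
  shows "(\<lambda>w. indicator A w *\<^sub>R Y w) \<in> borel_measurable (info T)"
proof -
  have [measurable]: "A \<in> sets (info T)" by (rule sets_info_mono[OF assms(1,2)])
  note [measurable] = assms(3)
  show ?thesis by measurable
qed

lemma g_unbiased:
  assumes Y: "Y \<in> borel_measurable (info (before k))" "square_integrable M Y"
  shows "(LINT w|M. Y w \<bullet> g k w) = (LINT w|M. Y w \<bullet> grad f (x k w))"
proof -
  note si = x_si[of k] h_si[of k]
  have YT: "Y \<in> borel_measurable (info T)" if "before k \<subseteq> T" for T
    by (rule measurable_info_mono[OF Y(1) that])
  have m: "(LINT w|M. Y w \<bullet> master_error k w) = 0"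
    by (rule master_error_orthogonal[OF si YT Y(2)]) auto
  have e: "(LINT w|M. Y w \<bullet> worker_error k i w) = 0" for i
    by (rule worker_error_orthogonal[OF si YT Y(2), of "insert (Sample k i) (before k)"]) auto
  have u: "(LINT w|M. Y w \<bullet> (stoch_grad k i w - grad (local_loss F i) (x k w))) = 0" for i
    by (rule stoch_grad_unbiased[OF si YT Y(2), of "before k"]) auto
  note int = square_integrable_inner[OF Y(2)]
  have int_m: "integrable M (\<lambda>w. Y w \<bullet> master_error k w)"
    by (intro int master_error_si si)
  have int_e: "integrable M (\<lambda>w. Y w \<bullet> worker_error k i w)" for i
    by (intro int worker_error_si si)
  have int_u: "integrable M (\<lambda>w. Y w \<bullet> (stoch_grad k i w - grad (local_loss F i) (x k w)))" for i
    by (intro int square_integrable_diff stoch_grad_si local_grad_si si)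
  have "g k w = grad f (x k w) + master_error k w + (1 / n) *\<^sub>R (\<Sum>i\<in>UNIV. worker_error k i w)
      + (1 / n) *\<^sub>R (\<Sum>i\<in>UNIV. stoch_grad k i w - grad (local_loss F i) (x k w))" if "w \<in> space M" for w
    using that by (simp add: master_error_def worker_error_def run_step(3) grad_global_loss
        sum.distrib sum_subtractf algebra_simps)
  then have "(LINT w|M. Y w \<bullet> g k w) = (LINT w|M. Y w \<bullet> grad f (x k w) + (Y w \<bullet> master_error k w
      + ((1 / n) * (\<Sum>i\<in>UNIV. Y w \<bullet> worker_error k i w)
      + (1 / n) * (\<Sum>i\<in>UNIV. Y w \<bullet> (stoch_grad k i w - grad (local_loss F i) (x k w))))))"
    by (intro Bochner_Integration.integral_cong) (simp_all add: inner_add_right inner_sum_right)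
  also have "\<dots> = (LINT w|M. Y w \<bullet> grad f (x k w)) + ((LINT w|M. Y w \<bullet> master_error k w)
      + ((1 / n) * (\<Sum>i\<in>UNIV. LINT w|M. Y w \<bullet> worker_error k i w)
      + (1 / n) * (\<Sum>i\<in>UNIV. LINT w|M. Y w \<bullet> (stoch_grad k i w - grad (local_loss F i) (x k w)))))"
  proof -
    have "square_integrable M (\<lambda>w. grad f (x k w))"
      unfolding grad_global_loss
      by (intro square_integrable_scaleR square_integrable_sum local_grad_si si)
    note int_f = int[OF this]
    have s1: "integrable M (\<lambda>w. (1 / n) * (\<Sum>i\<in>UNIV. Y w \<bullet> worker_error k i w))"
      by (intro integrable_mult_right Bochner_Integration.integrable_sum int_e)
    have s2: "integrable M (\<lambda>w. (1 / n) *
        (\<Sum>i\<in>UNIV. Y w \<bullet> (stoch_grad k i w - grad (local_loss F i) (x k w))))"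
      by (intro integrable_mult_right Bochner_Integration.integrable_sum int_u)
    show ?thesis
      by (simp only: Bochner_Integration.integral_add[OF int_f Bochner_Integration.integrable_add[OF int_m Bochner_Integration.integrable_add[OF s1 s2]]]
          Bochner_Integration.integral_add[OF int_m Bochner_Integration.integrable_add[OF s1 s2]]
          Bochner_Integration.integral_add[OF s1 s2] integral_mult_right_zero
          Bochner_Integration.integral_sum[OF int_e] Bochner_Integration.integral_sum[OF int_u])
  qed
  finally show ?thesis by (simp only: m e u) simp
qed

abbreviation (input) "shift_sq k w \<equiv> shift_dist_sq F xs (\<lambda>i. h k i w)"

lemma shift_sq_eq: "shift_sq k w = (1 / n) * (\<Sum>i\<in>UNIV. (norm (h k i w - opt i))\<^sup>2)"
  by (simp add: shift_dist_sq_def n_def)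

lemma shift_norm_integrable: "integrable M (\<lambda>w. (norm (h k i w - opt i))\<^sup>2)"
  by (intro square_integrable_norm square_integrable_diff h_si square_integrable_const)

lemma shift_sq_integrable: "integrable M (shift_sq k)"
  unfolding shift_sq_eq[abs_def]
  by (intro integrable_mult_right Bochner_Integration.integrable_sum shift_norm_integrable)

text \<open>Here \<open>\<alpha> (1 + \<omega>1) \<le> 1\<close> absorbs the quantization variance, which turns the new shift into
  a convex combination of the old one and the stochastic gradient.\<close>
lemma shift_step_pointwise:
  fixes u d :: 'a
  assumes "0 < \<alpha>" "\<alpha> \<le> 1 / (\<omega>1 + 1)"
  shows "(norm (u + \<alpha> *\<^sub>R d))\<^sup>2 + \<alpha>\<^sup>2 * (\<omega>1 * (norm d)\<^sup>2)
    \<le> (1 - \<alpha>) * (norm u)\<^sup>2 + \<alpha> * (norm (u + d))\<^sup>2"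
proof -
  have "\<alpha> * (\<omega>1 + 1) \<le> 1"
    using assms(2) omega_pos by (simp add: pos_le_divide_eq)
  then have "\<alpha> * (\<alpha> * (\<omega>1 + 1)) * (norm d)\<^sup>2 \<le> \<alpha> * 1 * (norm d)\<^sup>2"
    using assms(1) by (intro mult_right_mono mult_left_mono) auto
  then show ?thesis
    unfolding power2_norm_eq_inner
    by (simp add: inner_add inner_commute algebra_simps power2_eq_square)
qed

context
  fixes k :: nat and A :: "'w set"
  assumes A: "A \<in> sets (info (before k))"
begin

abbreviation (input) "E X \<equiv> expect_on M A X"

lemma A_M: "A \<in> sets M" by (rule sets_info_M[OF A])

lemma sum_stoch_diff_bound:
  "(\<Sum>i\<in>UNIV. E (\<lambda>w. (norm (stoch_grad k i w - stoch_grad_opt k i w))\<^sup>2))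
    \<le> 2 * \<L> * n * E (\<lambda>w. gap (x k w))"
proof -
  note si = x_si[of k] h_si[of k]
  have "(\<Sum>i\<in>UNIV. E (\<lambda>w. (norm (stoch_grad k i w - stoch_grad_opt k i w))\<^sup>2))
      \<le> (\<Sum>i\<in>UNIV. 2 * \<L> * E (\<lambda>w. breg i (x k w)))"
    by (intro sum_mono stoch_diff_bound[OF si] A)
  also have "\<dots> = 2 * \<L> * E (\<lambda>w. \<Sum>i\<in>UNIV. breg i (x k w))"
    by (subst expect_on_sum) (auto simp: sum_distrib_left A_M breg_integrable[OF si])
  also have "\<dots> = 2 * \<L> * n * E (\<lambda>w. gap (x k w))"
    unfolding sum_breg expect_on_cmult by simp
  finally show ?thesis .
qed

lemma sum_noise_bound:
  "(\<Sum>i\<in>UNIV. E (\<lambda>w. (norm (stoch_grad_opt k i w - opt i))\<^sup>2)) \<le> (\<Sum>i\<in>UNIV. noise i) * prob A"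
  unfolding sum_distrib_right by (intro sum_mono noise_bound[OF x_si h_si] A)

lemma sum_shift: "(\<Sum>i\<in>UNIV. E (\<lambda>w. (norm (h k i w - opt i))\<^sup>2)) = n * E (shift_sq k)"
proof -
  have "E (shift_sq k) = (1 / n) * (\<Sum>i\<in>UNIV. E (\<lambda>w. (norm (h k i w - opt i))\<^sup>2))"
    unfolding shift_sq_eq expect_on_cmult
    by (subst expect_on_sum) (auto simp: A_M shift_norm_integrable)
  then show ?thesis using n_pos by simp
qed

text \<open>The noise of another worker is determined by its own sample, for which the sample of worker \<open>j\<close> is
  fresh; so averaging over the workers divides the variance by their number.\<close>
lemma mean_noise_second_moment:
  "E (\<lambda>w. (norm ((1 / n) *\<^sub>R (\<Sum>i\<in>UNIV. stoch_grad_opt k i w - opt i)))\<^sup>2)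
    = (1 / n\<^sup>2) * (\<Sum>i\<in>UNIV. E (\<lambda>w. (norm (stoch_grad_opt k i w - opt i))\<^sup>2))"
proof -
  note si = x_si[of k] h_si[of k]
  have "E (\<lambda>w. (norm (\<Sum>i\<in>UNIV. stoch_grad_opt k i w - opt i))\<^sup>2)
      = (\<Sum>i\<in>UNIV. E (\<lambda>w. (norm (stoch_grad_opt k i w - opt i))\<^sup>2))"
  proof (rule integral_norm_sq_sum_orthogonal[OF noise_si[OF si] A_M])
    fix i j :: 'n assume "i \<noteq> j"
    let ?T = "insert (Sample k i) (before k)"
    have "(\<lambda>w. stoch_grad_opt k i w - opt i) \<in> borel_measurable (info ?T)"
      unfolding stoch_grad_opt_def
      by (intro borel_measurable_diff sampled_grad_measurable xi_info) auto
    then show "(LINT w|M. (indicator A w *\<^sub>R (stoch_grad_opt k i w - opt i)) \<bullet> (stoch_grad_opt k j w - opt j)) = 0"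
      using \<open>i \<noteq> j\<close>
      by (intro stoch_grad_opt_unbiased[OF si, of _ ?T] indicator_info[OF A]
          square_integrable_indicator[OF noise_si[OF si] A_M]) auto
  qed simp
  then show ?thesis
    using n_pos by (simp add: power_mult_distrib power_divide expect_on_cmult[of M A "1 / n\<^sup>2", simplified])
qed

lemma mean_worker_error_second_moment:
  "E (\<lambda>w. (norm ((1 / n) *\<^sub>R (\<Sum>i\<in>UNIV. worker_error k i w)))\<^sup>2)
    = (1 / n\<^sup>2) * (\<Sum>i\<in>UNIV. E (\<lambda>w. (norm (worker_error k i w))\<^sup>2))"
proof -
  note si = x_si[of k] h_si[of k]
  have "E (\<lambda>w. (norm (\<Sum>i\<in>UNIV. worker_error k i w))\<^sup>2)
      = (\<Sum>i\<in>UNIV. E (\<lambda>w. (norm (worker_error k i w))\<^sup>2))"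
  proof (rule integral_norm_sq_sum_orthogonal[OF worker_error_si[OF si] A_M])
    fix i j :: 'n assume "i \<noteq> j"
    \<comment> \<open>enough to determine the error of worker \<open>i\<close>, while the seed of worker \<open>j\<close> is still fresh\<close>
    let ?T = "before k \<union> range (Sample k) \<union> {Worker_Seed k i}"
    have "worker_error k i \<in> borel_measurable (info ?T)"
      unfolding worker_error_def[abs_def]
      by (intro borel_measurable_diff Delta_info stoch_grad_info x_info h_info) auto
    then show "(LINT w|M. (indicator A w *\<^sub>R worker_error k i w) \<bullet> worker_error k j w) = 0"
      using \<open>i \<noteq> j\<close>
      by (intro worker_error_orthogonal[OF si, of _ ?T] indicator_info[OF A]
          square_integrable_indicator[OF worker_error_si[OF si] A_M]) auto
  qed simp
  then show ?thesis
    using n_pos by (simp add: power_mult_distrib power_divide expect_on_cmult[of M A "1 / n\<^sup>2", simplified])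
qed

text \<open>Successive orthogonal splittings: first the master's error, then the worker errors, are removed
  from the second moment of \<open>g\<close>.\<close>
lemma g_second_moment_split:
  "E (\<lambda>w. (norm (g k w))\<^sup>2) \<le> (1 + \<omega>2) *
    (E (\<lambda>w. (norm ((1 / n) *\<^sub>R (\<Sum>i\<in>UNIV. stoch_grad k i w)))\<^sup>2)
     + E (\<lambda>w. (norm ((1 / n) *\<^sub>R (\<Sum>i\<in>UNIV. worker_error k i w)))\<^sup>2))"
proof -
  note si = x_si[of k] h_si[of k]
  let ?a = "\<lambda>w. (1 / n) *\<^sub>R (\<Sum>i\<in>UNIV. stoch_grad k i w)"
  let ?e = "\<lambda>w. (1 / n) *\<^sub>R (\<Sum>i\<in>UNIV. worker_error k i w)"
  have a_si: "square_integrable M ?a" and e_si: "square_integrable M ?e"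
    by (intro square_integrable_scaleR square_integrable_sum stoch_grad_si worker_error_si si)+
  have "E (\<lambda>w. (norm (g k w))\<^sup>2) = E (\<lambda>w. (norm (g2 k w + master_error k w))\<^sup>2)"
    by (simp add: master_error_def)
  also have "\<dots> = E (\<lambda>w. (norm (g2 k w))\<^sup>2) + E (\<lambda>w. (norm (master_error k w))\<^sup>2)"
    by (intro integral_norm_sq_add_orthogonal g2_si master_error_si si A_M
        master_error_orthogonal[OF si] indicator_info[OF A] g2_until_master
        square_integrable_indicator) auto
  also have "\<dots> \<le> (1 + \<omega>2) * E (\<lambda>w. (norm (g2 k w))\<^sup>2)"
    using master_error_bound[OF si A] by (simp add: distrib_right)
  also have "E (\<lambda>w. (norm (g2 k w))\<^sup>2) = E (\<lambda>w. (norm (?a w + ?e w))\<^sup>2)"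
    by (intro expect_on_cong)
      (simp add: run_step(3) worker_error_def sum.distrib sum_subtractf algebra_simps)
  also have "\<dots> = E (\<lambda>w. (norm (?a w))\<^sup>2) + E (\<lambda>w. (norm (?e w))\<^sup>2)"
  proof (rule integral_norm_sq_add_orthogonal[OF a_si e_si A_M])
    let ?T = "before k \<union> range (Sample k)"
    let ?Y = "\<lambda>w. indicator A w *\<^sub>R ?a w"
    have Y_si: "square_integrable M ?Y"
      by (rule square_integrable_indicator[OF a_si A_M])
    have "stoch_grad k i \<in> borel_measurable (info ?T)" for i
      by (intro stoch_grad_info x_info) auto
    then have "?a \<in> borel_measurable (info ?T)"
      by (intro borel_measurable_scaleR borel_measurable_const borel_measurable_sum) auto
    then have Y: "?Y \<in> borel_measurable (info ?T)"
      by (intro indicator_info[OF A]) auto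
    have 0: "(LINT w|M. ?Y w \<bullet> worker_error k i w) = 0" for i
      by (rule worker_error_orthogonal[OF si Y Y_si]) auto
    have "(LINT w|M. ?Y w \<bullet> ?e w) = (LINT w|M. (1 / n) * (\<Sum>i\<in>UNIV. ?Y w \<bullet> worker_error k i w))"
      by (simp only: inner_scaleR_right inner_sum_right)
    also have "\<dots> = (1 / n) * (\<Sum>i\<in>UNIV. LINT w|M. ?Y w \<bullet> worker_error k i w)"
      using square_integrable_inner[OF Y_si worker_error_si[OF si]]
      by (simp only: integral_mult_right_zero Bochner_Integration.integral_sum)
    finally show "(LINT w|M. ?Y w \<bullet> ?e w) = 0" by (simp only: 0) simp
  qed
  finally show ?thesis .
qed

text \<open>The local gradients at the minimizer sum to zero, so they can be subtracted for free; this leaves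
  only the centred noise, whose mean has a variance smaller by the factor \<open>n\<close>.\<close>
lemma mean_stoch_grad_second_moment:
  "E (\<lambda>w. (norm ((1 / n) *\<^sub>R (\<Sum>i\<in>UNIV. stoch_grad k i w)))\<^sup>2) \<le>
    2 / n * (\<Sum>i\<in>UNIV. E (\<lambda>w. (norm (stoch_grad k i w - stoch_grad_opt k i w))\<^sup>2))
    + 2 / n\<^sup>2 * (\<Sum>i\<in>UNIV. E (\<lambda>w. (norm (stoch_grad_opt k i w - opt i))\<^sup>2))"
proof -
  note si = x_si[of k] h_si[of k]
  let ?b = "\<lambda>w. (1 / n) * (\<Sum>i\<in>UNIV. (norm (stoch_grad k i w - stoch_grad_opt k i w))\<^sup>2)"
  let ?z = "\<lambda>w. (norm ((1 / n) *\<^sub>R (\<Sum>i\<in>UNIV. stoch_grad_opt k i w - opt i)))\<^sup>2"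
  have b: "integrable M ?b"
    by (intro integrable_mult_right Bochner_Integration.integrable_sum square_integrable_norm stoch_diff_si si)
  have z: "integrable M ?z"
    by (intro square_integrable_norm square_integrable_scaleR square_integrable_sum noise_si si)
  have a: "integrable M (\<lambda>w. (norm ((1 / n) *\<^sub>R (\<Sum>i\<in>UNIV. stoch_grad k i w)))\<^sup>2)"
    by (intro square_integrable_norm square_integrable_scaleR square_integrable_sum stoch_grad_si si)
  have "E (\<lambda>w. (norm ((1 / n) *\<^sub>R (\<Sum>i\<in>UNIV. stoch_grad k i w)))\<^sup>2) \<le> E (\<lambda>w. 2 * ?b w + 2 * ?z w)"
  proof (rule expect_on_mono[OF a _ A_M])
    show "integrable M (\<lambda>w. 2 * ?b w + 2 * ?z w)"
      by (intro Bochner_Integration.integrable_add integrable_mult_right[OF b] integrable_mult_right[OF z])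
    fix w
    have "(1 / n) *\<^sub>R (\<Sum>i\<in>UNIV. stoch_grad k i w) =
        (1 / n) *\<^sub>R (\<Sum>i\<in>UNIV. stoch_grad k i w - stoch_grad_opt k i w)
        + (1 / n) *\<^sub>R (\<Sum>i\<in>UNIV. stoch_grad_opt k i w - opt i)"
      by (simp add: sum_subtractf sum_opt scaleR_diff_right)
    then have "(norm ((1 / n) *\<^sub>R (\<Sum>i\<in>UNIV. stoch_grad k i w)))\<^sup>2 \<le>
        2 * (norm ((1 / n) *\<^sub>R (\<Sum>i\<in>UNIV. stoch_grad k i w - stoch_grad_opt k i w)))\<^sup>2 + 2 * ?z w"
      by (simp only: norm_sum_sq_le2)
    also have "(norm ((1 / n) *\<^sub>R (\<Sum>i\<in>UNIV. stoch_grad k i w - stoch_grad_opt k i w)))\<^sup>2 \<le> ?b w"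
      using norm_mean_sq_le[of UNIV "\<lambda>i. stoch_grad k i w - stoch_grad_opt k i w"] by (simp add: n_def)
    finally show "(norm ((1 / n) *\<^sub>R (\<Sum>i\<in>UNIV. stoch_grad k i w)))\<^sup>2 \<le> 2 * ?b w + 2 * ?z w"
      by simp
  qed
  also have "\<dots> = 2 * ((1 / n) * (\<Sum>i\<in>UNIV. E (\<lambda>w. (norm (stoch_grad k i w - stoch_grad_opt k i w))\<^sup>2)))
      + 2 * ((1 / n\<^sup>2) * (\<Sum>i\<in>UNIV. E (\<lambda>w. (norm (stoch_grad_opt k i w - opt i))\<^sup>2)))"
    unfolding expect_on_add[OF integrable_mult_right[OF b] integrable_mult_right[OF z] A_M]
      expect_on_cmult mean_noise_second_moment
    by (subst expect_on_sum) (auto simp: A_M intro!: square_integrable_norm stoch_diff_si si)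
  finally show ?thesis by simp
qed

lemma worker_error_second_moment:
  "E (\<lambda>w. (norm (worker_error k i w))\<^sup>2) \<le> \<omega>1 * (3 *
    (E (\<lambda>w. (norm (stoch_grad k i w - stoch_grad_opt k i w))\<^sup>2)
     + E (\<lambda>w. (norm (stoch_grad_opt k i w - opt i))\<^sup>2) + E (\<lambda>w. (norm (h k i w - opt i))\<^sup>2)))"
proof -
  note si = x_si[of k] h_si[of k]
  note int = square_integrable_norm[OF stoch_diff_si[OF si]] square_integrable_norm[OF noise_si[OF si]]
    shift_norm_integrable
  have "E (\<lambda>w. (norm (stoch_grad k i w - h k i w))\<^sup>2) \<le> E (\<lambda>w. 3 *
      ((norm (stoch_grad k i w - stoch_grad_opt k i w))\<^sup>2 + (norm (stoch_grad_opt k i w - opt i))\<^sup>2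
       + (norm (h k i w - opt i))\<^sup>2))"
  proof (rule expect_on_mono[OF square_integrable_norm[OF direction_si[OF si]] _ A_M])
    fix w
    show "(norm (stoch_grad k i w - h k i w))\<^sup>2 \<le> 3 *
      ((norm (stoch_grad k i w - stoch_grad_opt k i w))\<^sup>2 + (norm (stoch_grad_opt k i w - opt i))\<^sup>2
       + (norm (h k i w - opt i))\<^sup>2)"
      using norm_sum_sq_le3[of "stoch_grad k i w - stoch_grad_opt k i w" "stoch_grad_opt k i w - opt i"
          "opt i - h k i w"] by (simp add: norm_minus_commute)
  qed (intro integrable_mult_right Bochner_Integration.integrable_add int)
  also have "\<dots> = 3 * (E (\<lambda>w. (norm (stoch_grad k i w - stoch_grad_opt k i w))\<^sup>2)
     + E (\<lambda>w. (norm (stoch_grad_opt k i w - opt i))\<^sup>2) + E (\<lambda>w. (norm (h k i w - opt i))\<^sup>2))"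
    unfolding expect_on_cmult expect_on_add[OF Bochner_Integration.integrable_add[OF int(1,2)] int(3) A_M]
      expect_on_add[OF int(1,2) A_M] ..
  finally have "\<omega>1 * E (\<lambda>w. (norm (stoch_grad k i w - h k i w))\<^sup>2) \<le> \<omega>1 * \<dots>"
    using omega_pos by (intro mult_left_mono) auto
  with worker_error_bound[OF si A] show ?thesis by (rule order_trans)
qed

lemma g_second_moment:
  "E (\<lambda>w. (norm (g k w))\<^sup>2) \<le> 2 * (\<L> * (1 + \<omega>2) * (2 + 3 * \<omega>1 / n)) * E (\<lambda>w. gap (x k w))
    + 3 * \<omega>1 * (1 + \<omega>2) / n * E (shift_sq k)
    + (2 + 3 * \<omega>1) * (1 + \<omega>2) / n\<^sup>2 * (\<Sum>i\<in>UNIV. noise i) * prob A"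
proof -
  define B where "B = (\<Sum>i\<in>UNIV. E (\<lambda>w. (norm (stoch_grad k i w - stoch_grad_opt k i w))\<^sup>2))"
  define Z where "Z = (\<Sum>i\<in>UNIV. E (\<lambda>w. (norm (stoch_grad_opt k i w - opt i))\<^sup>2))"
  define S where "S = E (shift_sq k)"
  define G where "G = E (\<lambda>w. gap (x k w))"
  define V where "V = (\<Sum>i\<in>UNIV. noise i) * prob A"
  have "(\<Sum>i\<in>UNIV. E (\<lambda>w. (norm (worker_error k i w))\<^sup>2)) \<le> \<omega>1 * (3 * (B + Z + n * S))"
    unfolding B_def Z_def S_def sum_shift[symmetric] sum.distrib[symmetric] sum_distrib_left
    by (intro sum_mono worker_error_second_moment)
  then have e: "E (\<lambda>w. (norm ((1 / n) *\<^sub>R (\<Sum>i\<in>UNIV. worker_error k i w)))\<^sup>2)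
      \<le> 1 / n\<^sup>2 * (\<omega>1 * (3 * (B + Z + n * S)))"
    unfolding mean_worker_error_second_moment by (intro mult_left_mono) auto
  have "E (\<lambda>w. (norm (g k w))\<^sup>2)
      \<le> (1 + \<omega>2) * ((2 / n * B + 2 / n\<^sup>2 * Z) + 1 / n\<^sup>2 * (\<omega>1 * (3 * (B + Z + n * S))))"
    using omega_pos mean_stoch_grad_second_moment e unfolding B_def[symmetric] Z_def[symmetric]
    by (intro order_trans[OF g_second_moment_split] mult_left_mono add_mono) auto
  also have "\<dots> \<le> (1 + \<omega>2) * ((2 / n * (2 * \<L> * n * G) + 2 / n\<^sup>2 * V)
      + 1 / n\<^sup>2 * (\<omega>1 * (3 * (2 * \<L> * n * G + V + n * S))))"
    using omega_pos n_pos sum_stoch_diff_bound sum_noise_bound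
    unfolding B_def[symmetric] Z_def[symmetric] G_def[symmetric] V_def[symmetric]
    by (intro mult_left_mono add_mono order_refl) auto
  also have "\<dots> = 2 * (\<L> * (1 + \<omega>2) * (2 + 3 * \<omega>1 / n)) * G + 3 * \<omega>1 * (1 + \<omega>2) / n * S
      + (2 + 3 * \<omega>1) * (1 + \<omega>2) / n\<^sup>2 * V"
    using n_pos by (simp add: field_simps power2_eq_square)
  finally show ?thesis
    unfolding G_def S_def V_def by (simp add: mult.assoc)
qed

lemma shift_second_moment:
  assumes \<alpha>: "0 < \<alpha>" "\<alpha> \<le> 1 / (\<omega>1 + 1)"
  shows "E (shift_sq (Suc k)) \<le> (1 - \<alpha>) * E (shift_sq k)
    + 2 * (\<alpha> * (3 * \<L> + 4 * L)) * E (\<lambda>w. gap (x k w)) + 3 * \<alpha> / n * (\<Sum>i\<in>UNIV. noise i) * prob A"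
proof -
  note si = x_si[of k] h_si[of k]
  define b where "b i = E (\<lambda>w. (norm (stoch_grad k i w - stoch_grad_opt k i w))\<^sup>2)" for i
  define z where "z i = E (\<lambda>w. (norm (stoch_grad_opt k i w - opt i))\<^sup>2)" for i
  define s where "s i = E (\<lambda>w. (norm (h k i w - opt i))\<^sup>2)" for i
  have step: "E (\<lambda>w. (norm (h (Suc k) i w - opt i))\<^sup>2) \<le> (1 - \<alpha>) * s i + \<alpha> * (2 * b i + 2 * z i)" for i
  proof -
    let ?d = "\<lambda>w. stoch_grad k i w - h k i w" and ?u = "\<lambda>w. h k i w - opt i"
    let ?Y = "\<lambda>w. ?u w + \<alpha> *\<^sub>R ?d w"
    have Y_si: "square_integrable M ?Y"
      by (intro square_integrable_add square_integrable_diff square_integrable_scaleR stoch_grad_si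
          square_integrable_const si)
    let ?T = "insert (Sample k i) (before k)"
    have "?Y \<in> borel_measurable (info ?T)"
      by (intro borel_measurable_add borel_measurable_diff borel_measurable_scaleR
          borel_measurable_const stoch_grad_info x_info h_info) auto
    then have 0: "(LINT w|M. (indicator A w *\<^sub>R ?Y w) \<bullet> worker_error k i w) = 0"
      by (intro worker_error_orthogonal[OF si, of _ ?T] indicator_info[OF A]
          square_integrable_indicator[OF Y_si A_M]) auto
    have "E (\<lambda>w. (norm (h (Suc k) i w - opt i))\<^sup>2) = E (\<lambda>w. (norm (?Y w + \<alpha> *\<^sub>R worker_error k i w))\<^sup>2)"
      by (intro expect_on_cong) (simp add: run_step(2) worker_error_def algebra_simps)
    also have "\<dots> = E (\<lambda>w. (norm (?Y w))\<^sup>2) + E (\<lambda>w. (norm (\<alpha> *\<^sub>R worker_error k i w))\<^sup>2)"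
      using 0 by (intro integral_norm_sq_add_orthogonal Y_si square_integrable_scaleR worker_error_si si A_M)
        simp
    also have "E (\<lambda>w. (norm (\<alpha> *\<^sub>R worker_error k i w))\<^sup>2) = \<alpha>\<^sup>2 * E (\<lambda>w. (norm (worker_error k i w))\<^sup>2)"
      by (simp only: norm_scaleR power_mult_distrib power2_abs expect_on_cmult)
    also have "\<dots> \<le> \<alpha>\<^sup>2 * (\<omega>1 * E (\<lambda>w. (norm (?d w))\<^sup>2))"
      by (intro mult_left_mono worker_error_bound si A) simp
    also have "E (\<lambda>w. (norm (?Y w))\<^sup>2) + \<alpha>\<^sup>2 * (\<omega>1 * E (\<lambda>w. (norm (?d w))\<^sup>2))
        = E (\<lambda>w. (norm (?Y w))\<^sup>2 + \<alpha>\<^sup>2 * (\<omega>1 * (norm (?d w))\<^sup>2))"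
      using expect_on_add[OF square_integrable_norm[OF Y_si] integrable_mult_right[OF integrable_mult_right[OF
            square_integrable_norm[OF direction_si[OF si, of i]]]] A_M, of "\<alpha>\<^sup>2" \<omega>1]
      by (simp only: expect_on_cmult)
    also have "\<dots> \<le> E (\<lambda>w. (1 - \<alpha>) * (norm (?u w))\<^sup>2 + \<alpha> * (2 * (norm (stoch_grad k i w - stoch_grad_opt k i w))\<^sup>2
        + 2 * (norm (stoch_grad_opt k i w - opt i))\<^sup>2))"
    proof (rule expect_on_mono[OF _ _ A_M])
      fix w
      have "(norm (?Y w))\<^sup>2 + \<alpha>\<^sup>2 * (\<omega>1 * (norm (?d w))\<^sup>2) \<le> (1 - \<alpha>) * (norm (?u w))\<^sup>2 + \<alpha> * (norm (?u w + ?d w))\<^sup>2"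
        by (rule shift_step_pointwise[OF \<alpha>])
      also have "?u w + ?d w = (stoch_grad k i w - stoch_grad_opt k i w) + (stoch_grad_opt k i w - opt i)"
        by simp
      also have "(1 - \<alpha>) * (norm (?u w))\<^sup>2 + \<alpha> * (norm \<dots>)\<^sup>2 \<le> (1 - \<alpha>) * (norm (?u w))\<^sup>2
        + \<alpha> * (2 * (norm (stoch_grad k i w - stoch_grad_opt k i w))\<^sup>2 + 2 * (norm (stoch_grad_opt k i w - opt i))\<^sup>2)"
        using \<alpha>(1) by (intro add_left_mono mult_left_mono norm_sum_sq_le2) auto
      finally show "(norm (?Y w))\<^sup>2 + \<alpha>\<^sup>2 * (\<omega>1 * (norm (?d w))\<^sup>2) \<le> (1 - \<alpha>) * (norm (?u w))\<^sup>2
        + \<alpha> * (2 * (norm (stoch_grad k i w - stoch_grad_opt k i w))\<^sup>2 + 2 * (norm (stoch_grad_opt k i w - opt i))\<^sup>2)" .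
    qed (intro Bochner_Integration.integrable_add integrable_mult_right square_integrable_norm Y_si
        direction_si stoch_diff_si noise_si shift_norm_integrable si)+
    also have "\<dots> = (1 - \<alpha>) * s i + \<alpha> * (2 * b i + 2 * z i)"
    proof -
      note int = integrable_mult_right[OF square_integrable_norm[OF stoch_diff_si[OF si, of i]], of 2]
        integrable_mult_right[OF square_integrable_norm[OF noise_si[OF si, of i]], of 2]
      show ?thesis
        unfolding b_def z_def s_def
        by (simp only: expect_on_add[OF integrable_mult_right[OF shift_norm_integrable]
              integrable_mult_right[OF Bochner_Integration.integrable_add[OF int]] A_M]
            expect_on_add[OF int A_M] expect_on_cmult)
    qed
    finally show ?thesis by simp
  qed
  define B Z S G V where "B = (\<Sum>i\<in>UNIV. b i)" and "Z = (\<Sum>i\<in>UNIV. z i)" and "S = E (shift_sq k)"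
    and "G = E (\<lambda>w. gap (x k w))" and "V = (\<Sum>i\<in>UNIV. noise i) * prob A"
  have S: "(\<Sum>i\<in>UNIV. s i) = n * S"
    unfolding s_def S_def by (rule sum_shift)
  have B: "B \<le> 2 * \<L> * n * G" and Z: "Z \<le> V"
    unfolding B_def Z_def G_def V_def b_def z_def by (rule sum_stoch_diff_bound sum_noise_bound)+
  have G: "0 \<le> G" and V: "0 \<le> V"
    unfolding G_def V_def
    by (intro Bochner_Integration.integral_nonneg sum_nonneg mult_nonneg_nonneg gap_nonneg noise_nonneg;
        simp)+
  have "E (shift_sq (Suc k)) = (1 / n) * (\<Sum>i\<in>UNIV. E (\<lambda>w. (norm (h (Suc k) i w - opt i))\<^sup>2))"
    unfolding shift_sq_eq expect_on_cmult
    by (subst expect_on_sum) (auto simp: A_M shift_norm_integrable)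
  also have "\<dots> \<le> (1 / n) * (\<Sum>i\<in>UNIV. (1 - \<alpha>) * s i + \<alpha> * (2 * b i + 2 * z i))"
    using n_pos by (intro mult_left_mono sum_mono step) auto
  also have "\<dots> = (1 / n) * ((1 - \<alpha>) * (n * S) + \<alpha> * (2 * B + 2 * Z))"
    unfolding S[symmetric] B_def Z_def sum_distrib_left sum.distrib[symmetric] ..
  also have "\<dots> \<le> (1 / n) * ((1 - \<alpha>) * (n * S) + \<alpha> * (2 * (2 * \<L> * n * G) + 2 * V))"
    using n_pos \<alpha>(1) B Z by (intro mult_left_mono add_mono order_refl) auto
  also have "\<dots> = (1 - \<alpha>) * S + \<alpha> * (4 * \<L>) * G + 2 * \<alpha> / n * V"
    using n_pos by (simp add: field_simps)
  also have "\<dots> \<le> (1 - \<alpha>) * S + \<alpha> * (2 * (3 * \<L> + 4 * L)) * G + 3 * \<alpha> / n * V"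
    using \<alpha>(1) n_pos G V L_nonneg expected_smoothness_constant_nonneg
    by (intro add_mono mult_right_mono mult_left_mono divide_right_mono order_refl) auto
  finally show ?thesis
    unfolding S_def G_def V_def by (simp add: mult.assoc mult.left_commute)
qed

end

end

section \<open>The parametric assumption and the convergence rate\<close>

locale dianasr_dq_rates = dianasr_dq +
  fixes A' B1' D1' C1 D2 M1 T0 :: real
  assumes mu_nonneg: "\<mu> \<ge> 0"
    and gamma_pos: "0 < \<gamma>"
    and gamma_le: "\<gamma> \<le> 1 / (4 * (1 + \<omega>2) * (\<L> * (2 + 15 * \<omega>1 / n) + 16 * L * \<omega>1 / n))"
    and alpha_pos: "0 < \<alpha>"
    and alpha_le: "\<alpha> \<le> 1 / (\<omega>1 + 1)"
    and A'_def: "A' = \<L> * (1 + \<omega>2) * (2 + 3 * \<omega>1 / n)"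
    and B1'_def: "B1' = 3 * \<omega>1 * (1 + \<omega>2) / n"
    and D1'_def: "D1' = (2 + 3 * \<omega>1) * (1 + \<omega>2) / n\<^sup>2 * (\<Sum>i\<in>UNIV. LINT z|D i. noise_sq F xs i z)"
    and C1_def: "C1 = \<alpha> * (3 * \<L> + 4 * L)"
    and D2_def: "D2 = 3 * \<alpha> / n * (\<Sum>i\<in>UNIV. LINT z|D i. noise_sq F xs i z)"
    and M1_def: "M1 = 4 * \<omega>1 * (1 + \<omega>2) / (n * \<alpha>)"
    and T0_def: "T0 = (norm (x0 - xs))\<^sup>2 + M1 * \<gamma>\<^sup>2 * shift_dist_sq F xs h0"
begin

abbreviation (input) "\<eta> \<equiv> rate \<gamma> \<mu> \<alpha> 1"

lemma alpha_le_1: "\<alpha> \<le> 1"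
proof -
  have "1 / (\<omega>1 + 1) \<le> 1" using omega_pos by simp
  with alpha_le show ?thesis by linarith
qed

lemma rate_nonneg: "0 \<le> \<eta>" and rate_less_1: "\<eta> < 1"
  and rate_eq: "\<eta> = min (\<gamma> * \<mu> / 2) (\<alpha> / 4)"
  using mu_nonneg gamma_pos alpha_pos alpha_le_1 by (auto simp: rate_def)

lemma info_finite_subalgebra: "finite_measure_subalgebra M (info S)"
  by (intro finite_measure_subalgebra.intro finite_measure_subalgebra_axioms.intro
      info_subalgebra finite_measure_axioms)

lemma gap_info: "(\<lambda>w. gap (x k w)) \<in> borel_measurable (info (before k))"
proof -
  note [measurable] = x_info[of k "before k"]
  show ?thesis by measurable
qed

lemma shift_sq_info: "shift_sq k \<in> borel_measurable (info (before k))"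
proof -
  note [measurable] = h_info[of k "before k"]
  show ?thesis unfolding shift_sq_eq[abs_def] by measurable
qed

lemma cond_exp_g: "AE w in M. cond_exp_vec M (info (before k)) (g k) w = grad f (x k w)"
proof -
  note si = x_si[of k] h_si[of k]
  interpret S: finite_measure_subalgebra M "info (before k)" by (rule info_finite_subalgebra)
  have grad_si: "square_integrable M (\<lambda>w. grad f (x k w))"
    unfolding grad_global_loss
    by (intro square_integrable_scaleR square_integrable_sum local_grad_si si)
  have "AE w in M. real_cond_exp M (info (before k)) (\<lambda>w. g k w \<bullet> b) w = grad f (x k w) \<bullet> b" for b
  proof (rule S.real_cond_exp_charact)
    show "integrable M (\<lambda>w. g k w \<bullet> b)" "integrable M (\<lambda>w. grad f (x k w) \<bullet> b)"
      by (intro square_integrable_inner g_si grad_si square_integrable_const si)+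
    note [measurable] = x_info[of k "before k"]
    show "(\<lambda>w. grad f (x k w) \<bullet> b) \<in> borel_measurable (info (before k))" by measurable
    fix A assume A: "A \<in> sets (info (before k))"
    have "(\<lambda>w. indicator A w *\<^sub>R b) \<in> borel_measurable (info (before k))"
      by (rule indicator_info[OF A]) auto
    moreover have "square_integrable M (\<lambda>w. indicator A w *\<^sub>R b)"
      by (intro square_integrable_indicator square_integrable_const sets_info_M[OF A])
    ultimately have "(LINT w|M. (indicator A w *\<^sub>R b) \<bullet> g k w) = (LINT w|M. (indicator A w *\<^sub>R b) \<bullet> grad f (x k w))"
      by (rule g_unbiased)
    then show "(LINT w:A|M. g k w \<bullet> b) = (LINT w:A|M. grad f (x k w) \<bullet> b)"
      by (simp add: set_lebesgue_integral_def inner_commute)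
  qed
  then have "AE w in M. \<forall>b\<in>Basis. real_cond_exp M (info (before k)) (\<lambda>w. g k w \<bullet> b) w = grad f (x k w) \<bullet> b"
    by (intro AE_finite_allI) auto
  then show ?thesis
    by eventually_elim (simp add: cond_exp_vec_def euclidean_representation)
qed

lemma cond_second_moment_g:
  "AE w in M. real_cond_exp M (info (before k)) (\<lambda>w. (norm (g k w))\<^sup>2) w
    \<le> 2 * A' * gap (x k w) + B1' * shift_sq k w + D1'"
proof (rule real_cond_exp_leI[OF info_finite_subalgebra])
  note gi = gap_integrable[OF x_si h_si, of k] and si = shift_sq_integrable[of k]
  show "integrable M (\<lambda>w. (norm (g k w))\<^sup>2)"
    by (intro square_integrable_norm g_si x_si h_si)
  show "integrable M (\<lambda>w. 2 * A' * gap (x k w) + B1' * shift_sq k w + D1')"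
    by (intro Bochner_Integration.integrable_add integrable_mult_right gi si) simp
  show "(\<lambda>w. 2 * A' * gap (x k w) + B1' * shift_sq k w + D1') \<in> borel_measurable (info (before k))"
    by (intro borel_measurable_add borel_measurable_times borel_measurable_const gap_info shift_sq_info)
  fix A assume A: "A \<in> sets (info (before k))"
  note AM = sets_info_M[OF A]
  have "expect_on M A (\<lambda>w. 2 * A' * gap (x k w) + B1' * shift_sq k w + D1')
      = 2 * A' * expect_on M A (\<lambda>w. gap (x k w)) + B1' * expect_on M A (shift_sq k) + D1' * prob A"
    unfolding expect_on_add[OF Bochner_Integration.integrable_add[OF integrable_mult_right[OF gi]
          integrable_mult_right[OF si]] integrable_const AM]
      expect_on_add[OF integrable_mult_right[OF gi] integrable_mult_right[OF si] AM] expect_on_cmult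
    using AM by simp
  with g_second_moment[OF A]
  show "expect_on M A (\<lambda>w. (norm (g k w))\<^sup>2)
      \<le> expect_on M A (\<lambda>w. 2 * A' * gap (x k w) + B1' * shift_sq k w + D1')"
    unfolding A'_def B1'_def D1'_def by simp
qed

lemma cond_shift_sq:
  "AE w in M. real_cond_exp M (info (before k)) (shift_sq (Suc k)) w
    \<le> (1 - \<alpha>) * shift_sq k w + 2 * C1 * gap (x k w) + D2"
proof (rule real_cond_exp_leI[OF info_finite_subalgebra])
  note gi = gap_integrable[OF x_si h_si, of k] and si = shift_sq_integrable[of k]
  show "integrable M (shift_sq (Suc k))" by (rule shift_sq_integrable)
  show "integrable M (\<lambda>w. (1 - \<alpha>) * shift_sq k w + 2 * C1 * gap (x k w) + D2)"
    by (intro Bochner_Integration.integrable_add integrable_mult_right gi si) simp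
  show "(\<lambda>w. (1 - \<alpha>) * shift_sq k w + 2 * C1 * gap (x k w) + D2) \<in> borel_measurable (info (before k))"
    by (intro borel_measurable_add borel_measurable_times borel_measurable_const gap_info shift_sq_info)
  fix A assume A: "A \<in> sets (info (before k))"
  note AM = sets_info_M[OF A]
  have "expect_on M A (\<lambda>w. (1 - \<alpha>) * shift_sq k w + 2 * C1 * gap (x k w) + D2)
      = (1 - \<alpha>) * expect_on M A (shift_sq k) + 2 * C1 * expect_on M A (\<lambda>w. gap (x k w)) + D2 * prob A"
    unfolding expect_on_add[OF Bochner_Integration.integrable_add[OF integrable_mult_right[OF si]
          integrable_mult_right[OF gi]] integrable_const AM]
      expect_on_add[OF integrable_mult_right[OF si] integrable_mult_right[OF gi] AM] expect_on_cmult
    using AM by simp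
  with shift_second_moment[OF A alpha_pos alpha_le]
  show "expect_on M A (shift_sq (Suc k))
      \<le> expect_on M A (\<lambda>w. (1 - \<alpha>) * shift_sq k w + 2 * C1 * gap (x k w) + D2)"
    unfolding C1_def D2_def by simp
qed

lemma parametric_assumption_holds:
  "parametric_assumption M (past M \<xi> P1 U1 P2 U2) f xs L \<gamma> \<mu> x g (\<lambda>k w. 0) (\<lambda>k w. shift_sq k w) (\<lambda>k w. 0)
    A' B1' 0 D1' \<alpha> 1 C1 0 0 D2 0 0 0"
proof -
  note si = x_si h_si
  have zero: "AE w in M. real_cond_exp M (info (before k)) (\<lambda>w. 0) w \<le> 0" for k
    by (rule real_cond_exp_leI[OF info_finite_subalgebra]) auto
  have gaps: "0 \<le> (\<Sum>k\<le>K. weight \<eta> k * (LINT w|M. gap (x k w)))" for K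
    using rate_less_1 gap_nonneg
    by (intro sum_nonneg mult_nonneg_nonneg Bochner_Integration.integral_nonneg)
      (auto intro: less_imp_le weight_pos)
  show ?thesis
    unfolding parametric_assumption_def past_eq_info Let_def
    using cond_exp_g cond_second_moment_g cond_shift_sq zero gaps gap_integrable[OF si]
      shift_sq_integrable square_integrable_norm[OF g_si[OF si]]
      square_integrable_integrable[OF g_si[OF si]]
    by simp
qed

lemma M1_nonneg: "0 \<le> M1"
  using omega_pos n_pos alpha_pos by (simp add: M1_def)

text \<open>This is where the bound on \<open>\<gamma>\<close> and the value of \<open>M1\<close> come from: \<open>M1\<close> makes a quarter of the
  decay \<open>\<alpha>\<close> of the shifts survive after paying for \<open>B1'\<close>, and with it \<open>\<gamma> (A' + M1 C1) \<le> 1/4\<close>.\<close>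
lemma step_size_bound: "\<gamma> * (A' + M1 * C1) \<le> 1 / 4" and B1'_eq: "B1' = 3 / 4 * (\<alpha> * M1)"
proof -
  define den where "den = 4 * (1 + \<omega>2) * (\<L> * (2 + 15 * \<omega>1 / n) + 16 * L * \<omega>1 / n)"
  have le: "\<gamma> \<le> 1 / den" using gamma_le by (simp add: den_def)
  with gamma_pos have "0 < 1 / den" by linarith
  then have "0 < den" by simp
  with le have "\<gamma> * den \<le> 1" by (simp add: pos_le_divide_eq)
  moreover have "M1 * C1 = 4 * \<omega>1 * (1 + \<omega>2) / n * (3 * \<L> + 4 * L)"
    using alpha_pos n_pos by (simp add: M1_def C1_def)
  then have "den = 4 * (A' + M1 * C1)"
    using n_pos by (simp add: den_def A'_def field_simps)
  then have "\<gamma> * den = 4 * (\<gamma> * (A' + M1 * C1))" by simp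
  ultimately show "\<gamma> * (A' + M1 * C1) \<le> 1 / 4" by linarith
  show "B1' = 3 / 4 * (\<alpha> * M1)"
    using alpha_pos n_pos by (simp add: B1'_def M1_def)
qed

definition dist_sq :: "nat \<Rightarrow> real" where
  "dist_sq k = (LINT w|M. (norm (x k w - xs))\<^sup>2)"

definition mean_gap :: "nat \<Rightarrow> real" where
  "mean_gap k = (LINT w|M. gap (x k w))"

definition mean_shift :: "nat \<Rightarrow> real" where
  "mean_shift k = (LINT w|M. shift_sq k w)"

definition lyapunov :: "nat \<Rightarrow> real" where
  "lyapunov k = dist_sq k + M1 * \<gamma>\<^sup>2 * mean_shift k"

lemma dist_sq_nonneg: "0 \<le> dist_sq k"
  by (simp add: dist_sq_def)

lemma mean_gap_nonneg: "0 \<le> mean_gap k"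
  unfolding mean_gap_def by (intro Bochner_Integration.integral_nonneg gap_nonneg)

lemma shift_sq_nonneg: "0 \<le> shift_sq k w"
  using n_pos by (simp add: shift_sq_eq sum_nonneg)

lemma mean_shift_nonneg: "0 \<le> mean_shift k"
  unfolding mean_shift_def by (intro Bochner_Integration.integral_nonneg shift_sq_nonneg)

lemma lyapunov_nonneg: "0 \<le> lyapunov k"
  using dist_sq_nonneg mean_shift_nonneg M1_nonneg by (simp add: lyapunov_def)

lemma lyapunov_0: "lyapunov 0 = T0"
proof -
  have "dist_sq 0 = (LINT w|M. (norm (x0 - xs))\<^sup>2)"
    unfolding dist_sq_def by (intro Bochner_Integration.integral_cong) (auto simp: run_init)
  moreover have "mean_shift 0 = (LINT w|M. shift_dist_sq F xs h0)"
    unfolding mean_shift_def by (intro Bochner_Integration.integral_cong) (auto simp: run_init)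
  ultimately show ?thesis
    by (simp add: lyapunov_def T0_def prob_space)
qed

lemma T0_nonneg: "0 \<le> T0"
  using lyapunov_nonneg[of 0] by (simp add: lyapunov_0)

lemma variance_nonneg: "0 \<le> D1' + M1 * D2"
proof -
  have "0 \<le> (\<Sum>i\<in>UNIV. noise i)"
    by (intro sum_nonneg noise_nonneg)
  then show ?thesis
    unfolding D1'_def D2_def using M1_nonneg omega_pos n_pos alpha_pos
    by (intro add_nonneg_nonneg mult_nonneg_nonneg divide_nonneg_nonneg) auto
qed

text \<open>Quasi strong convexity turns the inner product with the mean direction into the gap plus a
  multiple of the squared distance.\<close>
lemma dist_sq_step:
  "dist_sq (Suc k) \<le> (1 - \<gamma> * \<mu>) * dist_sq k - 2 * \<gamma> * mean_gap k + \<gamma>\<^sup>2 * (LINT w|M. (norm (g k w))\<^sup>2)"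
proof -
  note si = x_si[of k] h_si[of k]
  let ?Y = "\<lambda>w. x k w - xs"
  have Y_si: "square_integrable M ?Y"
    by (intro square_integrable_diff square_integrable_const si)
  have Y_info: "?Y \<in> borel_measurable (info (before k))"
    by (intro borel_measurable_diff borel_measurable_const x_info) simp
  have grad_si: "square_integrable M (\<lambda>w. grad f (x k w))"
    unfolding grad_global_loss
    by (intro square_integrable_scaleR square_integrable_sum local_grad_si si)
  note int_Y = square_integrable_norm[OF Y_si] and int_g = square_integrable_norm[OF g_si[OF si]]
    and int_Yg = square_integrable_inner[OF Y_si g_si[OF si]]
  have "dist_sq (Suc k) = (LINT w|M. ((norm (?Y w))\<^sup>2 - (2 * \<gamma>) * (?Y w \<bullet> g k w)) + \<gamma>\<^sup>2 * (norm (g k w))\<^sup>2)"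
    unfolding dist_sq_def power2_norm_eq_inner
    by (intro Bochner_Integration.integral_cong)
      (simp_all add: run_step(5) inner_diff inner_commute algebra_simps
        power2_eq_square)
  also have "\<dots> = (dist_sq k - (2 * \<gamma>) * (LINT w|M. ?Y w \<bullet> g k w)) + \<gamma>\<^sup>2 * (LINT w|M. (norm (g k w))\<^sup>2)"
    unfolding dist_sq_def
    by (simp only: Bochner_Integration.integral_add[OF Bochner_Integration.integrable_diff[OF int_Y
            integrable_mult_right[OF int_Yg]] integrable_mult_right[OF int_g]]
        Bochner_Integration.integral_diff[OF int_Y integrable_mult_right[OF int_Yg]]
        integral_mult_right_zero)
  also have "(LINT w|M. ?Y w \<bullet> g k w) = (LINT w|M. ?Y w \<bullet> grad f (x k w))"
    by (rule g_unbiased[OF Y_info Y_si])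
  also have "mean_gap k + \<mu> / 2 * dist_sq k \<le> (LINT w|M. ?Y w \<bullet> grad f (x k w))"
  proof -
    note int_gap = gap_integrable[OF si] and int_mu = integrable_mult_right[OF int_Y, of "\<mu> / 2"]
    have "mean_gap k + \<mu> / 2 * dist_sq k = (LINT w|M. gap (x k w) + \<mu> / 2 * (norm (?Y w))\<^sup>2)"
      unfolding mean_gap_def dist_sq_def
      by (simp only: Bochner_Integration.integral_add[OF int_gap int_mu] integral_mult_right_zero)
    also have "\<dots> \<le> (LINT w|M. ?Y w \<bullet> grad f (x k w))"
    proof (intro integral_mono Bochner_Integration.integrable_add int_gap int_mu
        square_integrable_inner Y_si grad_si)
      fix w
      have "f xs \<ge> f (x k w) + grad f (x k w) \<bullet> (xs - x k w) + \<mu> / 2 * (norm (x k w - xs))\<^sup>2"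
        using qsc by (simp add: quasi_strongly_convex_def)
      then show "gap (x k w) + \<mu> / 2 * (norm (?Y w))\<^sup>2 \<le> ?Y w \<bullet> grad f (x k w)"
        by (simp add: inner_diff inner_commute)
    qed
    finally show ?thesis .
  qed
  then have "dist_sq k - (2 * \<gamma>) * (LINT w|M. ?Y w \<bullet> grad f (x k w)) + \<gamma>\<^sup>2 * (LINT w|M. (norm (g k w))\<^sup>2)
      \<le> dist_sq k - (2 * \<gamma>) * (mean_gap k + \<mu> / 2 * dist_sq k) + \<gamma>\<^sup>2 * (LINT w|M. (norm (g k w))\<^sup>2)"
    using gamma_pos by (intro add_mono diff_mono mult_left_mono order_refl) auto
  also have "\<dots> = (1 - \<gamma> * \<mu>) * dist_sq k - 2 * \<gamma> * mean_gap k + \<gamma>\<^sup>2 * (LINT w|M. (norm (g k w))\<^sup>2)"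
    by (simp add: algebra_simps)
  finally show ?thesis .
qed

lemma lyapunov_step:
  "lyapunov (Suc k) + 3 / 2 * \<gamma> * mean_gap k \<le> (1 - \<eta>) * lyapunov k + \<gamma>\<^sup>2 * (D1' + M1 * D2)"
proof -
  define R S G where "R = dist_sq k" and "S = mean_shift k" and "G = mean_gap k"
  have R: "0 \<le> R" and S: "0 \<le> S" and G: "0 \<le> G"
    by (simp_all add: R_def S_def G_def dist_sq_nonneg mean_shift_nonneg mean_gap_nonneg)
  \<comment> \<open>on the whole space the restricted expectations are the plain ones\<close>
  have sp: "space M \<in> sets (info (before k))"
    using sets.top[of "info (before k)"] by (simp add: space_info)
  have g2: "(LINT w|M. (norm (g k w))\<^sup>2) \<le> 2 * A' * G + B1' * S + D1'"
    using g_second_moment[OF sp] unfolding expect_on_space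
    by (simp add: prob_space A'_def B1'_def D1'_def G_def S_def mean_gap_def mean_shift_def)
  have s: "mean_shift (Suc k) \<le> (1 - \<alpha>) * S + 2 * C1 * G + D2"
    using shift_second_moment[OF sp alpha_pos alpha_le] unfolding expect_on_space
    by (simp add: prob_space C1_def D2_def G_def S_def mean_gap_def mean_shift_def)
  have "lyapunov (Suc k) \<le> ((1 - \<gamma> * \<mu>) * R - 2 * \<gamma> * G + \<gamma>\<^sup>2 * (2 * A' * G + B1' * S + D1'))
      + M1 * \<gamma>\<^sup>2 * ((1 - \<alpha>) * S + 2 * C1 * G + D2)"
    unfolding lyapunov_def
  proof (intro add_mono mult_left_mono s)
    have "\<gamma>\<^sup>2 * (LINT w|M. (norm (g k w))\<^sup>2) \<le> \<gamma>\<^sup>2 * (2 * A' * G + B1' * S + D1')"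
      by (intro mult_left_mono g2) simp
    with dist_sq_step[of k]
    show "dist_sq (Suc k) \<le> (1 - \<gamma> * \<mu>) * R - 2 * \<gamma> * G + \<gamma>\<^sup>2 * (2 * A' * G + B1' * S + D1')"
      unfolding R_def G_def by linarith
  qed (use M1_nonneg in simp)
  also have "\<dots> = (1 - \<gamma> * \<mu>) * R + M1 * \<gamma>\<^sup>2 * ((1 - \<alpha> / 4) * S)
      - 2 * \<gamma> * G + 2 * \<gamma> * (\<gamma> * (A' + M1 * C1)) * G + \<gamma>\<^sup>2 * (D1' + M1 * D2)"
    unfolding B1'_eq by (simp add: algebra_simps power2_eq_square)
  also have "\<dots> \<le> (1 - \<eta>) * R + M1 * \<gamma>\<^sup>2 * ((1 - \<eta>) * S)
      - 2 * \<gamma> * G + 2 * \<gamma> * (1 / 4) * G + \<gamma>\<^sup>2 * (D1' + M1 * D2)"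
  proof (intro add_mono diff_mono mult_right_mono mult_left_mono order_refl R S G variance_nonneg)
    have "\<eta> \<le> \<gamma> * \<mu> / 2" "\<eta> \<le> \<alpha> / 4" by (simp_all add: rate_eq)
    moreover have "0 \<le> \<gamma> * \<mu>" using gamma_pos mu_nonneg by simp
    ultimately show "\<eta> \<le> \<gamma> * \<mu>" "\<eta> \<le> \<alpha> / 4" by auto
  qed (use M1_nonneg gamma_pos step_size_bound in auto)
  also have "\<dots> = (1 - \<eta>) * lyapunov k - 3 / 2 * \<gamma> * G + \<gamma>\<^sup>2 * (D1' + M1 * D2)"
    by (simp add: lyapunov_def R_def S_def algebra_simps)
  finally show ?thesis by (simp add: G_def)
qed

lemma averaged_gap:
  fixes K :: nat
  defines "gap_avg \<equiv> \<lambda>w. gap (weighted_avg \<eta> x K w)"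
  shows "integrable M gap_avg"
    and "(LINT w|M. gap_avg w) \<le> 4 * (T0 / (\<gamma> * weight_sum \<eta> K)) + 4 * \<gamma> * (D1' + M1 * D2)"
proof -
  define W where "W = weight_sum \<eta> K"
  have W: "0 < W"
    unfolding W_def by (rule weight_sum_pos[OF rate_less_1])
  define B where "B = (\<lambda>w. (1 / W) * (\<Sum>k\<le>K. weight \<eta> k * gap (x k w)))"
  have int_B: "integrable M B"
    unfolding B_def
    by (intro integrable_mult_right Bochner_Integration.integrable_sum gap_integrable x_si h_si)
  have le: "gap_avg w \<le> B w" for w
  proof -
    have sum1: "(\<Sum>k\<le>K. weight \<eta> k / W) = 1"
      using W by (simp add: sum_divide_distrib[symmetric] W_def weight_sum_def)
    have "f (weighted_avg \<eta> x K w) = f (\<Sum>k\<le>K. (weight \<eta> k / W) *\<^sub>R x k w)"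
      by (simp add: weighted_avg_def W_def scaleR_sum_right)
    also have "\<dots> \<le> (\<Sum>k\<le>K. (weight \<eta> k / W) * f (x k w))"
      using W sum1 weight_pos[OF rate_less_1]
      by (intro convex_on_sum[OF _ _ convex_global]) (auto intro: less_imp_le)
    also have "\<dots> = B w + (\<Sum>k\<le>K. weight \<eta> k / W) * f xs"
      by (simp add: B_def sum_distrib_left sum_distrib_right sum.distrib[symmetric] algebra_simps)
    finally show ?thesis by (simp add: sum1 gap_avg_def)
  qed
  show int: "integrable M gap_avg"
  proof (rule Bochner_Integration.integrable_bound[OF int_B])
    show "gap_avg \<in> borel_measurable M"
      unfolding gap_avg_def weighted_avg_def by measurable
    show "AE w in M. norm (gap_avg w) \<le> norm (B w)"
      using le gap_nonneg by (intro AE_I2) (auto simp: gap_avg_def intro: order_trans[OF _ abs_ge_self])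
  qed
  have "3 / 2 * \<gamma> * (\<Sum>k\<le>K. weight \<eta> k * mean_gap k) \<le> T0 + \<gamma>\<^sup>2 * (D1' + M1 * D2) * W"
    using weighted_sum_of_contraction[of lyapunov "3 / 2 * \<gamma>" mean_gap, OF lyapunov_step rate_less_1 lyapunov_nonneg]
    by (simp add: lyapunov_0 W_def)
  then have main: "(1 / W) * (\<Sum>k\<le>K. weight \<eta> k * mean_gap k) \<le> 2 / 3 * (T0 / (\<gamma> * W) + \<gamma> * (D1' + M1 * D2))"
    using W gamma_pos by (simp add: field_simps power2_eq_square)
  have "(LINT w|M. gap_avg w) \<le> (LINT w|M. B w)"
    by (intro integral_mono int int_B le)
  also have "\<dots> = (1 / W) * (\<Sum>k\<le>K. weight \<eta> k * mean_gap k)"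
    unfolding B_def mean_gap_def
    by (simp only: integral_mult_right_zero
        Bochner_Integration.integral_sum[OF integrable_mult_right[OF gap_integrable[OF x_si h_si]]])
  also note main
  also have "2 / 3 * (T0 / (\<gamma> * W) + \<gamma> * (D1' + M1 * D2)) \<le> 4 * (T0 / (\<gamma> * W) + \<gamma> * (D1' + M1 * D2))"
    using T0_nonneg variance_nonneg W gamma_pos by (intro mult_right_mono add_nonneg_nonneg) auto
  finally show "(LINT w|M. gap_avg w) \<le> 4 * (T0 / (\<gamma> * weight_sum \<eta> K)) + 4 * \<gamma> * (D1' + M1 * D2)"
    by (simp add: W_def algebra_simps)
qed

lemma linear_rate:
  "(LINT w|M. gap (weighted_avg \<eta> x K w)) \<le> (1 - \<eta>) ^ K * (4 * T0 / \<gamma>) + 4 * \<gamma> * (D1' + M1 * D2)"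
proof -
  have "1 / weight_sum \<eta> K \<le> 1 / weight \<eta> K"
    using weight_sum_ge weight_sum_pos weight_pos rate_less_1
    by (intro divide_left_mono mult_pos_pos) auto
  also have "\<dots> = (1 - \<eta>) ^ (K + 1)" by (simp add: weight_def)
  also have "\<dots> \<le> (1 - \<eta>) ^ K"
    using rate_nonneg rate_less_1 by (intro power_decreasing) auto
  finally have "4 * T0 / \<gamma> * (1 / weight_sum \<eta> K) \<le> 4 * T0 / \<gamma> * (1 - \<eta>) ^ K"
    using T0_nonneg gamma_pos by (intro mult_left_mono) auto
  with averaged_gap(2)[of K] show ?thesis
    by (simp add: mult.commute)
qed

lemma sublinear_rate:
  assumes "\<mu> = 0" "0 < K"
  shows "(LINT w|M. gap (weighted_avg \<eta> x K w)) \<le> 4 * T0 / (\<gamma> * real K) + 4 * \<gamma> * (D1' + M1 * D2)"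
proof -
  have "\<eta> = 0" using assms alpha_pos by (simp add: rate_def)
  then have "weight_sum \<eta> K = real K + 1" by (simp add: weight_sum_def weight_def)
  then have "4 * (T0 / (\<gamma> * weight_sum \<eta> K)) \<le> 4 * (T0 / (\<gamma> * real K))"
    using assms T0_nonneg gamma_pos by (intro mult_left_mono divide_left_mono mult_pos_pos) auto
  with averaged_gap(2)[of K] show ?thesis by simp
qed

end

theorem theoremI1:
  fixes F :: "'n::finite \<Rightarrow> 'm::finite \<Rightarrow> 'a::euclidean_space \<Rightarrow> real"
    and D :: "'n \<Rightarrow> (real^'m) measure"
    and P1 :: "'u measure" and P2 :: "'v measure"
    and q1 :: "'a \<Rightarrow> 'u \<Rightarrow> 'a" and q2 :: "'a \<Rightarrow> 'v \<Rightarrow> 'a"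
    and M :: "'w measure"
    and \<xi> :: "nat \<Rightarrow> 'n \<Rightarrow> 'w \<Rightarrow> real^'m"
    and U1 :: "nat \<Rightarrow> 'n \<Rightarrow> 'w \<Rightarrow> 'u" and U2 :: "nat \<Rightarrow> 'w \<Rightarrow> 'v"
    and x g2 g :: "nat \<Rightarrow> 'w \<Rightarrow> 'a" and h \<Delta> :: "nat \<Rightarrow> 'n \<Rightarrow> 'w \<Rightarrow> 'a"
    and x0 xs :: 'a and h0 :: "'n \<Rightarrow> 'a"
    and L \<L> \<mu> \<gamma> \<alpha> \<omega>1 \<omega>2 n A' B1' D1' C1 D2 M1 T0 :: real
    and s1 :: "nat \<Rightarrow> 'w \<Rightarrow> real"
  assumes n_def: "n = real CARD('n)"
    and component_differentiable: "\<And>i j y. F i j differentiable (at y)"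
    and local_convex: "\<And>i. convex_on UNIV (local_loss F i)"
    and local_smooth: "\<And>i. smooth_fun L (local_loss F i)"
    and mu_nonneg: "\<mu> \<ge> 0"
    and qsc: "quasi_strongly_convex \<mu> (global_loss F) xs"
    and sampling: "\<And>i. sampling_distribution (D i)"
    and exp_smooth: "expected_smoothness F D \<L> xs"
    and finite_noise: "\<And>i. integrable (D i) (noise_sq F xs i)"
    and omega_pos: "\<omega>1 > 0" "\<omega>2 > 0"
    and quant1: "quantization \<omega>1 P1 q1"
    and quant2: "quantization \<omega>2 P2 q2"
    and randomness: "fresh_randomness M D \<xi> P1 U1 P2 U2"
    and run: "dianasr_dq_run F \<gamma> \<alpha> x0 h0 q1 q2 M \<xi> U1 U2 x h \<Delta> g2 g"
    and gamma_pos: "0 < \<gamma>"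
    and gamma_le: "\<gamma> \<le> 1 / (4 * (1 + \<omega>2) * (\<L> * (2 + 15 * \<omega>1 / n) + 16 * L * \<omega>1 / n))"
    and alpha_pos: "0 < \<alpha>"
    and alpha_le: "\<alpha> \<le> 1 / (\<omega>1 + 1)"
    and s1_def: "s1 = (\<lambda>k w. shift_dist_sq F xs (\<lambda>i. h k i w))"
    and A'_def: "A' = \<L> * (1 + \<omega>2) * (2 + 3 * \<omega>1 / n)"
    and B1'_def: "B1' = 3 * \<omega>1 * (1 + \<omega>2) / n"
    and D1'_def: "D1' = (2 + 3 * \<omega>1) * (1 + \<omega>2) / n\<^sup>2 * (\<Sum>i\<in>UNIV. LINT z|D i. noise_sq F xs i z)"
    and C1_def: "C1 = \<alpha> * (3 * \<L> + 4 * L)"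
    and D2_def: "D2 = 3 * \<alpha> / n * (\<Sum>i\<in>UNIV. LINT z|D i. noise_sq F xs i z)"
    and M1_def: "M1 = 4 * \<omega>1 * (1 + \<omega>2) / (n * \<alpha>)"
    and T0_def: "T0 = (norm (x0 - xs))\<^sup>2 + M1 * \<gamma>\<^sup>2 * shift_dist_sq F xs h0"
  shows "parametric_assumption M (past M \<xi> P1 U1 P2 U2) (global_loss F) xs L \<gamma> \<mu> x g
           (\<lambda>k w. 0) s1 (\<lambda>k w. 0)
           A' B1' 0 D1' \<alpha> 1 C1 0 0 D2 0 0 0 \<and>
    (let gap = (\<lambda>K w. global_loss F (weighted_avg (rate \<gamma> \<mu> \<alpha> 1) x K w) - global_loss F xs) in
      (\<forall>K. integrable M (gap K)) \<and>
      (\<mu> > 0 \<longrightarrow> (\<forall>K. (LINT w|M. gap K w)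
         \<le> (1 - min (\<gamma> * \<mu> / 2) (\<alpha> / 4)) ^ K * (4 * T0 / \<gamma>) + 4 * \<gamma> * (D1' + M1 * D2))) \<and>
      (\<mu> = 0 \<longrightarrow> (\<forall>K>0. (LINT w|M. gap K w)
         \<le> 4 * T0 / (\<gamma> * real K) + 4 * \<gamma> * (D1' + M1 * D2))))"
proof -
  interpret dianasr_dq_rates F D P1 P2 q1 q2 M \<xi> U1 U2 x g2 g h \<Delta> x0 xs h0 L \<L> \<mu> \<gamma> \<alpha> \<omega>1 \<omega>2 n
      A' B1' D1' C1 D2 M1 T0
    by (intro dianasr_dq_rates.intro dianasr_dq.intro dianasr_dq_rates_axioms.intro) fact+
  show ?thesis
    unfolding s1_def Let_def rate_eq[symmetric]
    using parametric_assumption_holds averaged_gap(1) linear_rate sublinear_rate by blast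
qed

end
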